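(* There exists an oracle $O \subseteq \mathbb{N}$ such that the following two statements hold simultaneously: (1) $\mathrm{NP}^O \cap \mathrm{coNP}^O$ does not contain a problem that is complete for $\mathrm{NP}^O\cap\mathrm{coNP}^O$ under polynomial-time many-one reductions computable with oracle $O$ (i.e. there is no $C \in \mathrm{NP}^O\cap\mathrm{coNP}^O$ with $A \le_m^{p,O} C$ for all $A\in \mathrm{NP}^O\cap\mathrm{coNP}^O$); (2) the set $\overline{K^O}$ has a $\mathrm{P}^O$-optimal proof system.
   Context: Let $\Sigma=\{0,1\}$; words in $\Sigma^*$ are identified with natural numbers via the polynomial-time computable and invertible bijection $w \mapsto \sum_{i<|w|}(1+w(i))2^{|w|-1-i}$, and $|n|$ denotes the length of $n$. Let $\langle\cdot\rangle:\bigcup_{i\ge0}\mathbb{N}^i\to\mathbb{N}$ be an injective, polynomial-time computable and invertible pairing function with $|\langle u_1,\dots,u_n\rangle| = 2(|u_1|+\dots+|u_n|+n)$. Let $M_1,M_2,\dots$ be a fixed standard enumeration of nondeterministic polynomial-time oracle Turing machines: for every oracle $D$ and input $x$, $M_i^D(x)$ stops within $|x|^i+i$ steps; every nondeterministic polynomial-time oracle machine is equivalent (for all oracles) to infinitely many $M_i$; and there is a nondeterministic polynomial-time oracle machine that on input $\langle i,x,0^{|x|^i+i}\rangle$ simulates $M_i^D(x)$. For an oracle $D$, $K^D = \{\langle 0^i,0^t,x\rangle : i\ge1,\ t,x\in\mathbb{N},\ M_i^D(x) \text{ accepts within } t \text{ steps}\}$; it is $\mathrm{NP}^D$-complete and $\overline{K^D}$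 (complement in $\Sigma^*$) is $\mathrm{coNP}^D$-complete. For sets $A,B$, $A\le_m^{p,D} B$ means there is $f\in \mathrm{FP}^D$ with $x\in A \Leftrightarrow f(x)\in B$ for all $x$. A proof system (relative to $D$) for a set $S$ is a function $f\in\mathrm{FP}^D$ with range exactly $S$. For $f,g\in\mathrm{FP}^D$, $f\le^{p,D} g$ ($g$ $\mathrm{P}^D$-simulates $f$) if there is $\pi\in\mathrm{FP}^D$ with $g(\pi(x))=f(x)$ for all $x$. A proof system $g$ for $S$ is $\mathrm{P}^D$-optimal if $f\le^{p,D} g$ for every proof system $f\in\mathrm{FP}^D$ with range $S$. *)

theory Defs
  imports Main
begin

text \<open>Words over {0,1} are bool lists (False = 0, True = 1).  The bijection
  w \<mapsto> sum_{i<|w|} (1 + w(i)) 2^(|w|-1-i).\<close>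

definition nat_of_word :: "bool list \<Rightarrow> nat" where
  "nat_of_word w = (\<Sum>i<length w. (1 + (if w ! i then 1 else 0)) * 2 ^ (length w - 1 - i))"

fun word_of_nat :: "nat \<Rightarrow> bool list" where
  "word_of_nat n = (if n = 0 then [] else word_of_nat ((n - 1) div 2) @ [even n])"

declare word_of_nat.simps[simp del]

definition len :: "nat \<Rightarrow> nat" where
  "len n = length (word_of_nat n)"

definition zeros :: "nat \<Rightarrow> nat" where
  "zeros k = nat_of_word (replicate k False)"

text \<open>Pairing function: every bit of u_j is doubled and each component is
  terminated by the separator 01; hence |<u_1..u_n>| = 2(|u_1|+...+|u_n|+n).\<close>
definition tuple :: "nat list \<Rightarrow> nat" where
  "tuple us = nat_of_word
     (concat (map (\<lambda>u. concat (map (\<lambda>b. [b, b]) (word_of_nat u)) @ [False, True]) us))"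

datatype sym = Bk | B0 | B1
datatype move = MoveL | MoveR | MoveS

text \<open>Two tapes (one-way infinite): a work tape (input/output) and an oracle
  query tape.  The transition relation maps (state, work symbol, query symbol)
  to (new state, written work symbol, written query symbol, moves).\<close>
record otm =
  delta :: "((nat \<times> sym \<times> sym) \<times> (nat \<times> sym \<times> sym \<times> move \<times> move)) set"
  q_start :: nat
  q_acc :: nat
  q_query :: nat
  q_yes :: nat
  q_no :: nat

datatype config = Config (st: nat) (wt: "nat \<Rightarrow> sym") (wh: nat) (qt: "nat \<Rightarrow> sym") (qh: nat)

fun mv :: "move \<Rightarrow> nat \<Rightarrow> nat" where
  "mv MoveL h = h - 1"
| "mv MoveR h = Suc h"
| "mv MoveS h = h"

definition tape_word :: "(nat \<Rightarrow> sym) \<Rightarrow> bool list" where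
  "tape_word t = (let k = (LEAST k. t k = Bk) in map (\<lambda>i. t i = B1) [0..<k])"

definition init :: "otm \<Rightarrow> nat \<Rightarrow> config" where
  "init M x = Config (q_start M)
     (\<lambda>i. if i < len x then (if word_of_nat x ! i then B1 else B0) else Bk) 0
     (\<lambda>_. Bk) 0"

definition step :: "otm \<Rightarrow> nat set \<Rightarrow> config \<Rightarrow> config \<Rightarrow> bool" where
  "step M D c c' =
    (if st c = q_acc M then False
     else if st c = q_query M then
       c' = Config (if nat_of_word (tape_word (qt c)) \<in> D then q_yes M else q_no M)
                   (wt c) (wh c) (\<lambda>_. Bk) 0
     else (\<exists>q' a b m1 m2. ((st c, wt c (wh c), qt c (qh c)), (q', a, b, m1, m2)) \<in> delta M \<and>
             c' = Config q' ((wt c)(wh c := a)) (mv m1 (wh c)) ((qt c)(qh c := b)) (mv m2 (qh c))))"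

definition reach :: "otm \<Rightarrow> nat set \<Rightarrow> nat \<Rightarrow> nat \<Rightarrow> config \<Rightarrow> bool" where
  "reach M D n x c = (step M D ^^ n) (init M x) c"

definition halted :: "otm \<Rightarrow> nat set \<Rightarrow> config \<Rightarrow> bool" where
  "halted M D c = (\<not> (\<exists>c'. step M D c c'))"

definition deterministic :: "otm \<Rightarrow> bool" where
  "deterministic M = (\<forall>k v v'. (k, v) \<in> delta M \<longrightarrow> (k, v') \<in> delta M \<longrightarrow> v = v')"

definition time_bound :: "otm \<Rightarrow> nat set \<Rightarrow> nat \<Rightarrow> bool" where
  "time_bound M D k = (\<forall>x n c. reach M D n x c \<longrightarrow> n \<le> len x ^ k + k)"

definition poly_time :: "otm \<Rightarrow> nat set \<Rightarrow> bool" where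
  "poly_time M D = (\<exists>k. time_bound M D k)"

definition np_otm :: "otm \<Rightarrow> bool" where
  "np_otm M = (finite (delta M) \<and> (\<exists>k. \<forall>D. time_bound M D k))"

definition accepts_within :: "otm \<Rightarrow> nat set \<Rightarrow> nat \<Rightarrow> nat \<Rightarrow> bool" where
  "accepts_within M D t x = (\<exists>n c. n \<le> t \<and> reach M D n x c \<and> st c = q_acc M)"

definition accepts :: "otm \<Rightarrow> nat set \<Rightarrow> nat \<Rightarrow> bool" where
  "accepts M D x = (\<exists>t. accepts_within M D t x)"

definition NP :: "nat set \<Rightarrow> nat set set" where
  "NP D = {L. \<exists>M. finite (delta M) \<and> poly_time M D \<and> L = {x. accepts M D x}}"

definition coNP :: "nat set \<Rightarrow> nat set set" where
  "coNP D = {L. - L \<in> NP D}"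

definition FP :: "nat set \<Rightarrow> (nat \<Rightarrow> nat) set" where
  "FP D = {f. \<exists>M. finite (delta M) \<and> deterministic M \<and> poly_time M D \<and>
              (\<forall>x. \<exists>n c. reach M D n x c \<and> halted M D c \<and> nat_of_word (tape_word (wt c)) = f x)}"

definition many_one :: "nat set \<Rightarrow> nat set \<Rightarrow> nat set \<Rightarrow> bool" where
  "many_one D A B = (\<exists>f \<in> FP D. \<forall>x. x \<in> A \<longleftrightarrow> f x \<in> B)"

definition standard_enum :: "(nat \<Rightarrow> otm) \<Rightarrow> bool" where
  "standard_enum Ms =
    ((\<forall>i\<ge>1. finite (delta (Ms i)) \<and> (\<forall>D. time_bound (Ms i) D i)) \<and>
     (\<forall>N. np_otm N \<longrightarrow>
        infinite {i. i \<ge> 1 \<and> (\<forall>D x. accepts (Ms i) D x \<longleftrightarrow> accepts N D x)}) \<and>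
     (\<exists>N. np_otm N \<and> (\<forall>D i x. i \<ge> 1 \<longrightarrow>
        (accepts N D (tuple [i, x, zeros (len x ^ i + i)]) \<longleftrightarrow> accepts (Ms i) D x))))"

definition K :: "(nat \<Rightarrow> otm) \<Rightarrow> nat set \<Rightarrow> nat set" where
  "K Ms D = {tuple [zeros i, zeros t, x] | i t x. i \<ge> 1 \<and> accepts_within (Ms i) D t x}"

definition proof_system :: "nat set \<Rightarrow> nat set \<Rightarrow> (nat \<Rightarrow> nat) \<Rightarrow> bool" where
  "proof_system D S f = (f \<in> FP D \<and> range f = S)"

definition p_sim :: "nat set \<Rightarrow> (nat \<Rightarrow> nat) \<Rightarrow> (nat \<Rightarrow> nat) \<Rightarrow> bool" where
  "p_sim D f g = (\<exists>\<pi> \<in> FP D. \<forall>x. g (\<pi> x) = f x)"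

definition optimal_ps :: "nat set \<Rightarrow> nat set \<Rightarrow> (nat \<Rightarrow> nat) \<Rightarrow> bool" where
  "optimal_ps D S g = (proof_system D S g \<and> (\<forall>f. proof_system D S f \<longrightarrow> p_sim D f g))"

end

theory Submission
  imports Defs "HOL-Library.Countable_Set"
begin

text \<open>The oracle contains the words of a set \<open>B\<close> and the bits of a function \<open>\<Gamma>\<close>, which will be the
  optimal proof system: \<open>\<Gamma>\<close> can be printed in linearly many rounds of queries.  Both are built by
  forcing, where a condition fixes them up to some length and assigns to finitely many tags
  either a machine \<open>M\<close> or a pair of nondeterministic machines.

  For a tag \<open>s\<close> and a function machine \<open>M\<close>, either some legal extension makes \<open>M\<close> output an
  element of \<open>K\<close>, and then \<open>M\<close> is never a proof system; or no legal extension does, and then we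
  promise that \<open>\<Gamma> (code s x)\<close> is the output of \<open>M\<close> on \<open>x\<close>.  The promise cannot make \<open>\<Gamma>\<close> unsound,
  since a first unsound value would be a legal extension of the second kind.

  For a tag \<open>c\<close> and a pair \<open>Ma\<close>, \<open>Mb\<close>, either some legal extension makes both or none of them
  accept some \<open>q\<close>, and then they do not accept complementary languages; or we promise that on every
  level \<open>n\<close> exactly one of two kinds of tagged words occurs in \<open>B\<close>, which puts a new language \<open>A\<close>
  into the intersection of NP and coNP.  To spoil a reduction \<open>f\<close> of \<open>A\<close> to the language of \<open>Ma\<close>,
  empty the level \<open>n\<close>.  This violates the promise, but not soundness: a proof of unsoundness only
  depends on polynomially many words of \<open>B\<close>, hence would survive the addition of a suitable word.
  So one of \<open>Ma\<close>, \<open>Mb\<close> accepts \<open>f (zeros n)\<close>, and it still does after adding a word of the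
  opposite kind outside of the polynomially many words that matter.\<close>

section \<open>Words and numbers\<close>

lemma nat_of_word_Nil [simp]: "nat_of_word [] = 0"
  by (simp add: nat_of_word_def)

lemma nat_of_word_snoc: "nat_of_word (w @ [b]) = 2 * nat_of_word w + (if b then 2 else 1)"
proof -
  have "(\<Sum>i<length w. (1 + (if (w @ [b]) ! i then 1 else 0)) * 2 ^ (length w - i)) =
        (\<Sum>i<length w. 2 * ((1 + (if w ! i then 1 else 0)) * 2 ^ (length w - 1 - i)) :: nat)"
  proof (rule sum.cong)
    fix i assume "i \<in> {..<length w}"
    then have i: "i < length w" by simp
    then have "length w - i = Suc (length w - 1 - i)" by simp
    then have "(2::nat) ^ (length w - i) = 2 * 2 ^ (length w - 1 - i)" by (metis power_Suc)
    then show "(1 + (if (w @ [b]) ! i then 1 else 0)) * 2 ^ (length w - i) =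
        2 * ((1 + (if w ! i then 1 else 0)) * 2 ^ (length w - 1 - i) :: nat)"
      using i by (simp add: nth_append)
  qed simp
  then show ?thesis
    by (simp add: nat_of_word_def sum_distrib_left)
qed

lemma word_of_nat_0 [simp]: "word_of_nat 0 = []"
  by (simp add: word_of_nat.simps)

lemma word_of_nat_of_word [simp]: "word_of_nat (nat_of_word w) = w"
proof (induction w rule: rev_induct)
  case (snoc b w)
  then show ?case
    by (subst word_of_nat.simps) (auto simp: nat_of_word_snoc)
qed simp

lemma nat_of_word_of_nat [simp]: "nat_of_word (word_of_nat n) = n"
proof (induction n rule: less_induct)
  case (less n)
  show ?case
  proof (cases "n = 0")
    case False
    then have "nat_of_word (word_of_nat ((n - 1) div 2)) = (n - 1) div 2"
      by (intro less) linarith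
    then show ?thesis using False
      by (subst word_of_nat.simps) (auto simp: nat_of_word_snoc elim!: evenE oddE)
  qed simp
qed

lemma word_of_nat_eq_iff [simp]: "word_of_nat m = word_of_nat n \<longleftrightarrow> m = n"
  by (metis nat_of_word_of_nat)

lemma len_nat_of_word [simp]: "len (nat_of_word w) = length w"
  by (simp add: len_def)

lemma length_word_of_nat [simp]: "length (word_of_nat n) = len n"
  by (simp add: len_def)

lemma len_zeros [simp]: "len (zeros k) = k"
  by (simp add: zeros_def)

lemma len_tuple: "len (tuple us) = (\<Sum>u\<leftarrow>us. 2 * len u + 2)"
proof -
  have "length (concat (map (\<lambda>b. [b, b]) w)) = 2 * length w" for w :: "bool list"
    by (induction w) auto
  then show ?thesis
    unfolding tuple_def len_nat_of_word by (induction us) auto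
qed

section \<open>Locality of oracle computations\<close>

definition qword :: "config \<Rightarrow> nat" where
  "qword c = nat_of_word (tape_word (qt c))"

lemma step_cong:
  assumes "st c = q_query M \<longrightarrow> (qword c \<in> D \<longleftrightarrow> qword c \<in> D')"
  shows "step M D c = step M D' c"
  using assms by (auto simp: step_def qword_def fun_eq_iff)

text \<open>The work tape starts with an input of length \<open>a\<close>, the query tape starts
  blank. Hence the two bounds \<open>a + n\<close> and \<open>n\<close>.\<close>

definition within :: "nat \<Rightarrow> nat \<Rightarrow> config \<Rightarrow> bool" where
  "within a n c \<longleftrightarrow> (\<forall>i\<ge>a + n. wt c i = Bk) \<and> wh c \<le> a + n \<and> (\<forall>i\<ge>n. qt c i = Bk) \<and> qh c \<le> n"

lemma within_init: "within (len x) 0 (init M x)"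
  by (simp add: within_def init_def)

lemma mv_le: "mv m h \<le> Suc h"
  by (cases m) auto

lemma within_step:
  assumes "within a n c" "step M D c c'"
  shows "within a (Suc n) c'"
proof -
  have *: "mv m h \<le> Suc k" if "h \<le> k" for m h k
    using mv_le[of m h] that by linarith
  show ?thesis
    using assms by (auto simp: step_def within_def * split: if_splits)
qed

lemma within_Suc: "within a n c \<Longrightarrow> within a (Suc n) c"
  by (auto simp: within_def)

lemma length_tape_word: "t n = Bk \<Longrightarrow> length (tape_word t) \<le> n"
  by (simp add: tape_word_def Let_def Least_le)

lemma within_qword: "within a n c \<Longrightarrow> len (qword c) \<le> n"
  by (simp add: within_def qword_def length_tape_word)

lemma within_out: "within a n c \<Longrightarrow> length (tape_word (wt c)) \<le> a + n"
  by (simp add: within_def length_tape_word)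

text \<open>Certificates as for decision trees. The running time bounds both their size and the
  lengths of their words: lengths preserve facts along extensions (\<open>cert_agr\<close>), the
  size serves the counting in the diagonalisation.\<close>

definition cert :: "nat \<Rightarrow> nat set \<Rightarrow> (nat set \<Rightarrow> bool) \<Rightarrow> bool" where
  "cert n D P \<longleftrightarrow> (\<exists>Q. finite Q \<and> card Q \<le> n \<and> (\<forall>v\<in>Q. len v \<le> n) \<and>
     (\<forall>D'. (\<forall>v\<in>Q. v \<in> D \<longleftrightarrow> v \<in> D') \<longrightarrow> P D'))"

definition agr :: "nat \<Rightarrow> nat set \<Rightarrow> nat set \<Rightarrow> bool" where
  "agr n D D' \<longleftrightarrow> (\<forall>v. len v \<le> n \<longrightarrow> (v \<in> D \<longleftrightarrow> v \<in> D'))"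

lemma agr_sym: "agr n D D' \<Longrightarrow> agr n D' D"
  by (auto simp: agr_def)

lemma agr_mono: "agr n D D' \<Longrightarrow> m \<le> n \<Longrightarrow> agr m D D'"
  by (auto simp: agr_def)

lemma cert_agr: "cert n D P \<Longrightarrow> agr n D D' \<Longrightarrow> P D'"
  unfolding cert_def agr_def by blast

lemma cert_mono:
  assumes "cert m D P" "m \<le> n" "\<And>D'. P D' \<Longrightarrow> R D'"
  shows "cert n D R"
proof -
  obtain Q where Q: "finite Q" "card Q \<le> m" "\<forall>v\<in>Q. len v \<le> m"
     "\<forall>D'. (\<forall>v\<in>Q. v \<in> D \<longleftrightarrow> v \<in> D') \<longrightarrow> P D'"
    using assms(1) unfolding cert_def by blast
  show ?thesis
    unfolding cert_def using Q assms(2,3) by (intro exI[of _ Q]) fastforce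
qed

lemma cert_step:
  assumes "cert n D P" "\<And>D'. P D' \<Longrightarrow> (v \<in> D \<longleftrightarrow> v \<in> D') \<Longrightarrow> R D'" "len v \<le> Suc n"
  shows "cert (Suc n) D R"
proof -
  obtain Q where Q: "finite Q" "card Q \<le> n" "\<forall>v\<in>Q. len v \<le> n"
     "\<forall>D'. (\<forall>v\<in>Q. v \<in> D \<longleftrightarrow> v \<in> D') \<longrightarrow> P D'"
    using assms(1) unfolding cert_def by blast
  show ?thesis
    unfolding cert_def
  proof (intro exI[of _ "insert v Q"] conjI)
    show "card (insert v Q) \<le> Suc n"
      using Q(1,2) by (simp add: card_insert_if)
    show "\<forall>v\<in>insert v Q. len v \<le> Suc n"
      using Q(3) assms(3) by auto
  qed (use Q assms(2) in auto)
qed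

lemma reach_within: "reach M D n x c \<Longrightarrow> within (len x) n c"
  unfolding reach_def
proof (induction n arbitrary: c)
  case 0
  then show ?case using within_init by auto
next
  case (Suc n)
  then show ?case by (auto intro: within_step)
qed

lemma cert_reach:
  "reach M D n x c \<Longrightarrow> cert n D (\<lambda>D'. reach M D' n x c)"
proof (induction n arbitrary: c)
  case 0
  then show ?case
    by (auto simp: cert_def reach_def intro!: exI[of _ "{}"])
next
  case (Suc n)
  then obtain b where b: "reach M D n x b" "step M D b c"
    unfolding reach_def by auto
  show ?case
  proof (rule cert_step[OF Suc.IH[OF b(1)]])
    fix D' assume "reach M D' n x b" "qword b \<in> D \<longleftrightarrow> qword b \<in> D'"
    then show "reach M D' (Suc n) x c"
      using b(2) step_cong[of b M D D'] unfolding reach_def by auto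
  next
    show "len (qword b) \<le> Suc n"
      using within_qword[OF reach_within[OF b(1)]] by simp
  qed
qed

lemma cert_accepts_within:
  assumes "accepts_within M D t x"
  shows "cert t D (\<lambda>D'. accepts_within M D' t x)"
proof -
  obtain n c where "n \<le> t" "reach M D n x c" "st c = q_acc M"
    using assms unfolding accepts_within_def by blast
  then show ?thesis
    by (intro cert_mono[OF cert_reach]) (auto simp: accepts_within_def)
qed

lemma accepts_within_agr:
  "agr t D D' \<Longrightarrow> accepts_within M D t x \<longleftrightarrow> accepts_within M D' t x"
  using cert_agr[OF cert_accepts_within] agr_sym by blast

text \<open>The step bound \<open>t\<close> is part of \<open>y\<close> in unary, hence at most
  \<open>len y\<close>, and the accepting run is the certificate.\<close>

lemma cert_K:
  assumes "y \<in> K Ms D"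
  shows "cert (len y) D (\<lambda>D'. y \<in> K Ms D')"
proof -
  obtain i t x where y: "y = tuple [zeros i, zeros t, x]" "i \<ge> 1" "accepts_within (Ms i) D t x"
    using assms unfolding K_def by blast
  have "t \<le> len y" by (simp add: y(1) len_tuple)
  then show ?thesis
    by (rule cert_mono[OF cert_accepts_within[OF y(3)]]) (use y in \<open>auto simp: K_def\<close>)
qed

lemma K_agr: "agr (len y) D D' \<Longrightarrow> y \<in> K Ms D \<longleftrightarrow> y \<in> K Ms D'"
  using cert_agr[OF cert_K] agr_sym by blast

text \<open>A tuple with three entries has positive length. Therefore the empty word is always a
  sound value of \<Gamma> and can serve as default.\<close>

lemma zero_notin_K: "0 \<notin> K Ms D"
proof
  assume "0 \<in> K Ms D"
  then obtain i t x where "0 = tuple [zeros i, zeros t, x]" unfolding K_def by blast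
  then have "len 0 = len (tuple [zeros i, zeros t, x])" by simp
  then show False by (simp add: len_tuple len_def[of 0])
qed

section \<open>Deterministic clocked evaluation of arbitrary machines\<close>

definition nxt :: "otm \<Rightarrow> nat set \<Rightarrow> config \<Rightarrow> config" where
  "nxt M D c = (if \<exists>c'. step M D c c' then SOME c'. step M D c c' else c)"

text \<open>\<open>nxt\<close> idles on halted configurations, so this is total for every machine;
  for a deterministic one it is the output as soon as the clock reaches the running time.\<close>

definition clocked :: "otm \<Rightarrow> nat \<Rightarrow> nat set \<Rightarrow> nat \<Rightarrow> nat" where
  "clocked M s D x = nat_of_word (tape_word (wt ((nxt M D ^^ (len x ^ s + s)) (init M x))))"

lemma within_nxt: "within a n c \<Longrightarrow> within a (Suc n) (nxt M D c)"
  using someI_ex[of "step M D c"] by (auto simp: nxt_def intro: within_step within_Suc)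

lemma within_nxts: "within (len x) n ((nxt M D ^^ n) (init M x))"
  by (induction n) (auto intro: within_init within_nxt)

lemma len_clocked: "len (clocked M s D x) \<le> len x + (len x ^ s + s)"
  using within_out[OF within_nxts] by (simp add: clocked_def)

text \<open>\<open>SOME\<close> is applied to the whole successor relation, which by
  \<open>step_cong\<close> is the same for oracles that agree on the pending query. So the choice is
  the same, even if \<open>M\<close> is nondeterministic.\<close>

lemma cert_nxts:
  "cert n D (\<lambda>D'. (nxt M D' ^^ n) (init M x) = (nxt M D ^^ n) (init M x))"
proof (induction n)
  case 0
  then show ?case
    by (auto simp: cert_def intro!: exI[of _ "{}"])
next
  case (Suc n)
  let ?b = "(nxt M D ^^ n) (init M x)"
  show ?case
  proof (rule cert_step[OF Suc.IH])
    fix D' assume "(nxt M D' ^^ n) (init M x) = ?b" "qword ?b \<in> D \<longleftrightarrow> qword ?b \<in> D'"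
    then show "(nxt M D' ^^ Suc n) (init M x) = (nxt M D ^^ Suc n) (init M x)"
      using step_cong[of ?b M D D'] by (simp add: nxt_def)
  next
    show "len (qword ?b) \<le> Suc n"
      using within_qword[OF within_nxts[of x n M D]] by simp
  qed
qed

lemma cert_clocked:
  "cert (len x ^ s + s) D (\<lambda>D'. clocked M s D' x = clocked M s D x)"
  by (rule cert_mono[OF cert_nxts[of _ D M x] order_refl]) (simp add: clocked_def)

lemma clocked_agr:
  "agr (len x ^ s + s) D D' \<Longrightarrow> clocked M s D x = clocked M s D' x"
  using cert_agr[OF cert_clocked] by metis

lemma deterministic_step:
  assumes "deterministic M" "step M D c c1" "step M D c c2"
  shows "c1 = c2"
proof -
  have det: "v = v'" if "(k, v) \<in> delta M" "(k, v') \<in> delta M" for k v v'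
    using assms(1) that unfolding deterministic_def by blast
  show ?thesis
    using assms(2,3) unfolding step_def by (auto split: if_splits dest: det)
qed

lemma reach_nxt:
  assumes "deterministic M" "reach M D n x c"
  shows "(nxt M D ^^ n) (init M x) = c"
  using assms(2)
proof (induction n arbitrary: c)
  case 0
  then show ?case by (simp add: reach_def)
next
  case (Suc n)
  then obtain b where b: "reach M D n x b" "step M D b c"
    unfolding reach_def by auto
  have "nxt M D b = c"
    using b(2) someI[of "step M D b"] deterministic_step[OF assms(1)] unfolding nxt_def by metis
  then show ?case using Suc.IH[OF b(1)] by simp
qed

lemma halted_nxt: "halted M D c \<Longrightarrow> (nxt M D ^^ n) c = c"
  by (induction n) (auto simp: halted_def nxt_def)

lemma nxts_halted:
  assumes "deterministic M" "reach M D n x c" "halted M D c" "n \<le> m"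
  shows "(nxt M D ^^ m) (init M x) = c"
proof -
  have "(nxt M D ^^ m) (init M x) = (nxt M D ^^ (m - n)) ((nxt M D ^^ n) (init M x))"
    using assms(4) by (metis comp_apply funpow_add le_add_diff_inverse2)
  then show ?thesis using assms by (simp add: reach_nxt halted_nxt)
qed

lemma clocked_eq:
  assumes "deterministic M" "reach M D n x c" "halted M D c" "n \<le> len x ^ s + s"
  shows "clocked M s D x = nat_of_word (tape_word (wt c))"
  using nxts_halted[OF assms] by (simp add: clocked_def)

text \<open>A deterministic machine has a single run. A time bound thus follows by exhibiting one
  short halting run for each input.\<close>

lemma deterministic_time:
  assumes "deterministic M" "reach M D n x c" "halted M D c" "reach M D m x b"
  shows "m \<le> n"
proof (rule ccontr)
  assume "\<not> m \<le> n"
  then obtain l where m: "m = Suc l" "n \<le> l" by (metis not_less less_eq_Suc_le Suc_le_D Suc_le_mono)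
  then obtain a where a: "reach M D l x a" "step M D a b"
    using assms(4) unfolding reach_def by auto
  have "a = c"
    using reach_nxt[OF assms(1) a(1)] nxts_halted[OF assms(1-3) m(2)] by simp
  then show False using a(2) assms(3) by (auto simp: halted_def)
qed

section \<open>Polynomial bounds\<close>

lemma power_bound_mono: "a \<le> b \<Longrightarrow> 1 \<le> b \<Longrightarrow> (n::nat) ^ a + a \<le> n ^ b + b"
proof (cases "n = 0")
  case False
  assume "a \<le> b"
  then show ?thesis using False by (simp add: add_mono power_increasing)
qed (auto simp: power_0_left)

lemma time_bound_mono: "time_bound M D a \<Longrightarrow> a \<le> b \<Longrightarrow> 1 \<le> b \<Longrightarrow> time_bound M D b"
  unfolding time_bound_def using power_bound_mono order_trans by meson

text \<open>The base \<open>m + 2\<close> is at least 2, so a larger exponent absorbs constants and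
  sums.\<close>

definition polyb :: "(nat \<Rightarrow> nat) \<Rightarrow> bool" where
  "polyb f \<longleftrightarrow> (\<exists>k. \<forall>m. f m \<le> (m + 2) ^ k)"

lemma less_two_pow: "(n::nat) < (m + 2) ^ n"
proof -
  have "n < 2 ^ n" by simp
  also have "\<dots> \<le> (m + 2) ^ n" by (simp add: power_mono)
  finally show ?thesis .
qed

lemma polyb_const [intro]: "polyb (\<lambda>_. c)"
  unfolding polyb_def using less_two_pow less_imp_le by blast

lemma polyb_id [intro]: "polyb (\<lambda>m. m)"
  unfolding polyb_def by (rule exI[of _ 1]) simp

lemma polyb_mult [intro]: "polyb f \<Longrightarrow> polyb g \<Longrightarrow> polyb (\<lambda>m. f m * g m)"
  unfolding polyb_def by (metis mult_le_mono power_add)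

lemma polyb_add [intro]:
  assumes "polyb f" "polyb g" shows "polyb (\<lambda>m. f m + g m)"
proof -
  obtain a b where ab: "\<And>m. f m \<le> (m + 2) ^ a" "\<And>m. g m \<le> (m + 2) ^ b"
    using assms unfolding polyb_def by blast
  have "f m + g m \<le> (m + 2) ^ (a + b + 1)" for m
  proof -
    have "(m + 2) ^ a \<le> (m + 2) ^ (a + b)" "(m + 2) ^ b \<le> (m + 2) ^ (a + b)"
      by (rule power_increasing; simp)+
    then have "f m + g m \<le> 2 * (m + 2) ^ (a + b)"
      using ab[of m] by linarith
    also have "\<dots> \<le> (m + 2) ^ (a + b + 1)" by simp
    finally show ?thesis .
  qed
  then show ?thesis unfolding polyb_def by blast
qed

lemma polyb_power [intro]: "polyb f \<Longrightarrow> polyb (\<lambda>m. f m ^ k)"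
  by (induction k) auto

lemma polyb_time:
  assumes "polyb f" shows "\<exists>k. \<forall>m. f m \<le> m ^ k + k"
proof -
  obtain a where a: "\<And>m. f m \<le> (m + 2) ^ a" using assms unfolding polyb_def by blast
  \<comment> \<open>For \<open>m \<ge> 2\<close> one has \<open>m + 2 \<le> m * m\<close>, whence
    the degree \<open>2 * a\<close>; for \<open>m \<le> 1\<close> the additive constant
    \<open>3 ^ a\<close> suffices.\<close>
  have "f m \<le> m ^ (2 * a + 3 ^ a) + (2 * a + 3 ^ a)" for m
  proof (cases "m \<le> 1")
    case True
    then have "(m + 2) ^ a \<le> 3 ^ a" by (simp add: power_mono)
    then show ?thesis using a[of m] by linarith
  next
    case False
    then have "m + 2 \<le> 2 * m" by simp
    also have "\<dots> \<le> m * m" using False by (simp add: mult_le_mono)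
    finally have "(m + 2) ^ a \<le> (m\<^sup>2) ^ a" by (simp add: power_mono power2_eq_square)
    also have "\<dots> = m ^ (2 * a)" by (simp add: power_mult)
    also have "\<dots> \<le> m ^ (2 * a + 3 ^ a)" using False by (simp add: power_increasing)
    finally show ?thesis using a[of m] by linarith
  qed
  then show ?thesis by blast
qed

lemma polyb_less_exp:
  assumes "polyb f" shows "\<exists>n\<ge>m. f n < 2 ^ n"
proof -
  obtain k where k: "\<And>m. f m \<le> (m + 2) ^ k" using assms unfolding polyb_def by blast
  \<comment> \<open>With \<open>n = 2 ^ (2 * j)\<close> the polynomial is at most
    \<open>2 ^ ((2 * j + 1) * k)\<close>, and \<open>j \<ge> 4 * k\<close> makes this exponent
    smaller than \<open>n\<close>.\<close>
  define j where "j = m + 4 * k + 4"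
  define n where "n = (2::nat) ^ (2 * j)"
  have "j < 2 ^ j" by simp
  have jn: "j < n" unfolding n_def using less_exp[of "2 * j"] by linarith
  have "n + 2 \<le> 2 * n" using jn j_def by simp
  then have "n + 2 \<le> 2 ^ (2 * j + 1)" by (simp add: n_def)
  then have "(n + 2) ^ k \<le> (2 ^ (2 * j + 1)) ^ k" by (rule power_mono) simp
  also have "\<dots> = 2 ^ ((2 * j + 1) * k)" by (simp only: power_mult[symmetric])
  also have "(2 * j + 1) * k < n"
  proof -
    have "(2 * j + 1) * k \<le> (4 * j) * k" by (rule mult_le_mono1) (simp add: j_def)
    also have "\<dots> = j * (4 * k)" by simp
    also have "\<dots> \<le> j * j" by (rule mult_le_mono2) (simp add: j_def)
    also have "\<dots> < 2 ^ j * 2 ^ j" using \<open>j < 2 ^ j\<close> by (intro mult_strict_mono) auto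
    also have "\<dots> = n" by (simp add: n_def mult_2 power_add)
    finally show ?thesis .
  qed
  then have "(2::nat) ^ ((2 * j + 1) * k) < 2 ^ n" by simp
  finally have "f n < 2 ^ n" using k[of n] by linarith
  moreover have "m \<le> n" using jn j_def by simp
  ultimately show ?thesis by blast
qed

section \<open>The oracle\<close>

text \<open>Self-delimiting from the right: the zeros after the last 1 give \<open>n\<close>. In
  unary, a machine can increment \<open>n\<close> by appending a zero.\<close>

definition marked :: "bool list \<Rightarrow> nat \<Rightarrow> bool list" where
  "marked w n = w @ True # replicate n False"

lemma length_marked [simp]: "length (marked w n) = length w + n + 1"
  by (simp add: marked_def)

lemma marked_eq_iff [simp]: "marked u m = marked v n \<longleftrightarrow> u = v \<and> m = n"
proof
  assume eq: "marked u m = marked v n"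
  have tw: "takeWhile Not (rev (marked w k)) = replicate k False" for w k
    by (simp add: marked_def takeWhile_append)
  have "m = n" using tw[of u m] tw[of v n] eq by (metis length_replicate)
  then show "u = v \<and> m = n" using eq by (simp add: marked_def)
qed simp

text \<open>Bounds the time as well as the output length of a machine with clock exponent
  \<open>s\<close> on inputs of length \<open>m\<close>.\<close>

definition bnd :: "nat \<Rightarrow> nat \<Rightarrow> nat" where
  "bnd s m = m + m ^ s + s"

text \<open>The padding makes a code longer than every query of the evaluated machine, so a promised
  value refers to shorter oracle words only. It is squared because up to \<open>bnd\<close> queries
  may each depend on up to \<open>bnd\<close> words of \<open>B\<close>.\<close>

definition code :: "nat \<Rightarrow> bool list \<Rightarrow> bool list" where
  "code s x = marked (marked x s) ((bnd s (length x))\<^sup>2)"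

lemma code_eq_iff [simp]: "code s x = code t y \<longleftrightarrow> s = t \<and> x = y"
  by (auto simp: code_def)

lemma length_code: "length (code s x) = length x + s + 2 + (bnd s (length x))\<^sup>2"
  by (simp add: code_def)

lemma bnd_less_length_code: "bnd s (length x) < length (code s x)"
proof -
  have "bnd s (length x) \<le> (bnd s (length x))\<^sup>2" by (simp add: power2_eq_square)
  then show ?thesis by (simp add: length_code)
qed

text \<open>Keeps the all-zero words free of promises, so that any sound value can be stored
  there.\<close>

lemma code_neq_zeros: "code s x \<noteq> replicate n False"
proof
  assume "code s x = replicate n False"
  moreover have "True \<in> set (code s x)" by (simp add: code_def marked_def)
  ultimately show False by simp
qed

text \<open>Level 0 displays \<Gamma>, level \<open>p > 0\<close> the codes of tag \<open>p\<close>.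
  Thus one kind of machine computes both the proof system and the translation into it, without
  arithmetic on tapes.\<close>

definition Phi :: "(bool list \<Rightarrow> bool list) \<Rightarrow> nat \<Rightarrow> bool list \<Rightarrow> bool list" where
  "Phi \<Gamma> p z = (if p = 0 then \<Gamma> z else code p z)"

text \<open>Words ending in 0 carry \<open>B\<close>. The displays end in 1:
  \<open>b = False\<close> asks whether position \<open>j\<close> exists, \<open>b = True\<close>
  whether it holds a 1.\<close>

definition orc :: "bool list set \<Rightarrow> (bool list \<Rightarrow> bool list) \<Rightarrow> nat set" where
  "orc B \<Gamma> = {v. (\<exists>w. word_of_nat v = w @ [False] \<and> w @ [False] \<in> B) \<or>
     (\<exists>z p j b. word_of_nat v = marked (marked z p) j @ [b, True] \<and>
        j < length (Phi \<Gamma> p z) \<and> (b \<longrightarrow> Phi \<Gamma> p z ! j))}"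

lemma orc_snoc_False: "nat_of_word (w @ [False]) \<in> orc B \<Gamma> \<longleftrightarrow> w @ [False] \<in> B"
  by (simp add: orc_def)

lemma orc_display: "nat_of_word (marked (marked z p) j @ [b, True]) \<in> orc B \<Gamma> \<longleftrightarrow>
    j < length (Phi \<Gamma> p z) \<and> (b \<longrightarrow> Phi \<Gamma> p z ! j)"
proof -
  have "marked (marked z p) j @ [b, True] = marked (marked z' p') j' @ [b', True] \<longleftrightarrow>
     z = z' \<and> p = p' \<and> j = j' \<and> b = b'" for z' p' j' b'
    by (subst append_eq_append_conv) auto
  moreover have "marked (marked z p) j @ [b, True] \<noteq> w @ [False]" for w
  proof
    assume "marked (marked z p) j @ [b, True] = w @ [False]"
    then have "last (marked (marked z p) j @ [b, True]) = last (w @ [False])" by metis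
    then show False by simp
  qed
  ultimately show ?thesis unfolding orc_def by simp
qed

lemma orc_cases:
  obtains (base) w where "word_of_nat v = w @ [False]"
  | (disp) z p j b where "word_of_nat v = marked (marked z p) j @ [b, True]"
  | (none) "\<And>B \<Gamma>. v \<notin> orc B \<Gamma>"
  unfolding orc_def by blast

definition agree :: "nat \<Rightarrow> bool list set \<Rightarrow> (bool list \<Rightarrow> bool list) \<Rightarrow> bool list set \<Rightarrow>
    (bool list \<Rightarrow> bool list) \<Rightarrow> bool" where
  "agree m B \<Gamma> B' \<Gamma>' \<longleftrightarrow>
     (\<forall>w. length w \<le> m \<longrightarrow> (w \<in> B \<longleftrightarrow> w \<in> B') \<and> \<Gamma> w = \<Gamma>' w)"

lemma agree_refl [simp]: "agree m B \<Gamma> B \<Gamma>"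
  by (simp add: agree_def)

lemma agree_trans: "agree m B \<Gamma> B' \<Gamma>' \<Longrightarrow> agree m B' \<Gamma>' B'' \<Gamma>'' \<Longrightarrow> agree m B \<Gamma> B'' \<Gamma>''"
  by (simp add: agree_def)

lemma agree_mono: "agree n B \<Gamma> B' \<Gamma>' \<Longrightarrow> m \<le> n \<Longrightarrow> agree m B \<Gamma> B' \<Gamma>'"
  by (simp add: agree_def)

text \<open>A word displaying a bit of \<open>\<Gamma> z\<close> is longer than \<open>z\<close>.
  The resulting strict inequality makes the recursion for \<Gamma> well-founded.\<close>

lemma agr_orc_less:
  assumes "\<And>w. length w \<le> m \<Longrightarrow> w \<in> B \<longleftrightarrow> w \<in> B'" "\<And>z. length z < m \<Longrightarrow> \<Gamma> z = \<Gamma>' z"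
  shows "agr m (orc B \<Gamma>) (orc B' \<Gamma>')"
  unfolding agr_def
proof (intro allI impI)
  fix v assume v: "len v \<le> m"
  show "v \<in> orc B \<Gamma> \<longleftrightarrow> v \<in> orc B' \<Gamma>'"
  proof (cases v rule: orc_cases)
    case (base w)
    then have "v = nat_of_word (w @ [False])" by (metis nat_of_word_of_nat)
    then show ?thesis using assms(1) v by (simp add: orc_snoc_False)
  next
    case (disp z p j b)
    then have v': "v = nat_of_word (marked (marked z p) j @ [b, True])"
      by (metis nat_of_word_of_nat)
    then have "length z < m" using v by simp
    then have "Phi \<Gamma> p z = Phi \<Gamma>' p z" using assms(2) by (simp add: Phi_def)
    then show ?thesis unfolding v' orc_display by simp
  qed simp
qed

lemma agr_orc: "agree m B \<Gamma> B' \<Gamma>' \<Longrightarrow> agr m (orc B \<Gamma>) (orc B' \<Gamma>')"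
  by (rule agr_orc_less) (auto simp: agree_def)

section \<open>Conditions\<close>

datatype tag = Unused | Fun otm | Con otm otm nat

definition eval_word :: "otm \<Rightarrow> nat \<Rightarrow> nat set \<Rightarrow> bool list \<Rightarrow> bool list" where
  "eval_word M s D x = word_of_nat (clocked M s D (nat_of_word x))"

lemma length_eval_word: "length (eval_word M s D x) \<le> bnd s (length x)"
  using len_clocked[of M s D "nat_of_word x"] by (simp add: eval_word_def bnd_def)

lemma cert_eval_word:
  "cert (bnd s (length x)) D (\<lambda>D'. eval_word M s D' x = eval_word M s D x)"
  by (rule cert_mono[OF cert_clocked[of "nat_of_word x" s D M]]) (auto simp: bnd_def eval_word_def)

lemma eval_word_agr:
  "agr (bnd s (length x)) D D' \<Longrightarrow> eval_word M s D x = eval_word M s D' x"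
  using cert_agr[OF cert_eval_word] by metis

text \<open>\<open>t\<close> is the kind, \<open>c\<close> the tag and \<open>length y\<close> the
  level. With \<open>Suc c\<close> zeros the word ends in 0 even for \<open>c = 0\<close>, so it
  lies in the part of the oracle that carries \<open>B\<close>.\<close>

definition gword :: "bool \<Rightarrow> bool list \<Rightarrow> nat \<Rightarrow> bool list" where
  "gword t y c = marked (t # y) (Suc c)"

lemma gword_eq_iff [simp]: "gword t y c = gword t' y' c' \<longleftrightarrow> t = t' \<and> y = y' \<and> c = c'"
  by (auto simp: gword_def)

lemma gword_snoc: "gword t y c = (t # y @ True # replicate c False) @ [False]"
  by (simp add: gword_def marked_def replicate_append_same)

lemma length_gword: "length (gword t y c) = length y + c + 3"
  by (simp add: gword_def)

lemma gword_orc: "nat_of_word (gword t y c) \<in> orc B \<Gamma> \<longleftrightarrow> gword t y c \<in> B"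
  unfolding gword_snoc by (rule orc_snoc_False)

definition has :: "bool list set \<Rightarrow> nat \<Rightarrow> bool \<Rightarrow> nat \<Rightarrow> bool" where
  "has B c t n \<longleftrightarrow> (\<exists>y. length y = n \<and> gword t y c \<in> B)"

definition exclusive :: "bool list set \<Rightarrow> nat \<Rightarrow> bool" where
  "exclusive B c \<longleftrightarrow> (\<forall>n. has B c True n \<noteq> has B c False n)"

definition acc :: "otm \<Rightarrow> nat \<Rightarrow> nat set \<Rightarrow> nat \<Rightarrow> bool" where
  "acc M k D q = accepts_within M D (len q ^ k + k) q"

text \<open>The tags below \<open>r\<close> bind. Values are checked up to length \<open>u\<close>,
  exclusivity on all levels. As values are no longer than their arguments, soundness up to
  \<open>u\<close> is decided by oracle words of length at most \<open>u\<close>.\<close>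

definition legal :: "(nat \<Rightarrow> otm) \<Rightarrow> nat \<Rightarrow> nat \<Rightarrow> (nat \<Rightarrow> tag) \<Rightarrow> bool list set \<Rightarrow>
    (bool list \<Rightarrow> bool list) \<Rightarrow> bool" where
  "legal Ms r u \<tau> B \<Gamma> \<longleftrightarrow>
     (\<forall>s<r. \<forall>M. \<tau> s = Fun M \<longrightarrow>
        (\<forall>x. length (code s x) \<le> u \<longrightarrow> \<Gamma> (code s x) = eval_word M s (orc B \<Gamma>) x)) \<and>
     (\<forall>s<r. \<forall>Ma Mb k. \<tau> s = Con Ma Mb k \<longrightarrow> exclusive B s) \<and>
     (\<forall>z. length z \<le> u \<longrightarrow>
        length (\<Gamma> z) \<le> length z \<and> nat_of_word (\<Gamma> z) \<notin> K Ms (orc B \<Gamma>))"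

text \<open>The bound \<open>u\<close> makes a violation survive every change of the oracle on words
  longer than \<open>u\<close>.\<close>

fun bad :: "(nat \<Rightarrow> otm) \<Rightarrow> tag \<Rightarrow> nat \<Rightarrow> nat \<Rightarrow> nat set \<Rightarrow> bool" where
  "bad Ms Unused s u D = False"
| "bad Ms (Fun M) s u D =
     (\<exists>x. bnd s (length x) \<le> u \<and> nat_of_word (eval_word M s D x) \<in> K Ms D)"
| "bad Ms (Con Ma Mb k) s u D =
     (\<exists>q. len q ^ k + k \<le> u \<and> (acc Ma k D q \<longleftrightarrow> acc Mb k D q))"

lemma K_eval_word_agr:
  assumes "agr (bnd s (length x)) D D'"
  shows "nat_of_word (eval_word M s D x) \<in> K Ms D \<longleftrightarrow> nat_of_word (eval_word M s D' x) \<in> K Ms D'"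
proof -
  have "nat_of_word (eval_word M s D x) \<in> K Ms D \<longleftrightarrow> nat_of_word (eval_word M s D x) \<in> K Ms D'"
    by (rule K_agr) (use agr_mono[OF assms] length_eval_word in simp)
  then show ?thesis using eval_word_agr[OF assms] by simp
qed

lemma bad_agr:
  assumes "agr u D D'" "bad Ms T s u D" shows "bad Ms T s u D'"
proof (cases T)
  case (Fun M)
  then obtain x where "bnd s (length x) \<le> u" "nat_of_word (eval_word M s D x) \<in> K Ms D"
    using assms(2) by auto
  then show ?thesis
    using Fun K_eval_word_agr[OF agr_mono[OF assms(1)]] by auto
next
  case (Con Ma Mb k)
  then obtain q where q: "len q ^ k + k \<le> u" "acc Ma k D q \<longleftrightarrow> acc Mb k D q"
    using assms(2) by auto
  then have "acc Ma k D' q \<longleftrightarrow> acc Mb k D' q"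
    using accepts_within_agr[OF agr_mono[OF assms(1) q(1)]] by (simp add: acc_def)
  then show ?thesis using Con q(1) by auto
qed (use assms in simp)

text \<open>Refers to the moment when tag \<open>s\<close> is issued: words of length at most
  \<open>s - 1\<close> are fixed and only the tags below \<open>s\<close> bind. As all legal
  extensions of that situation are considered, safety is inherited by later conditions.\<close>

definition safe :: "(nat \<Rightarrow> otm) \<Rightarrow> nat \<Rightarrow> (nat \<Rightarrow> tag) \<Rightarrow> bool list set \<Rightarrow>
    (bool list \<Rightarrow> bool list) \<Rightarrow> tag \<Rightarrow> bool" where
  "safe Ms s \<tau> B \<Gamma> T \<longleftrightarrow> (\<forall>u B' \<Gamma>'. s \<le> Suc u \<longrightarrow> agree (s - 1) B \<Gamma> B' \<Gamma>' \<longrightarrow>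
     legal Ms s u \<tau> B' \<Gamma>' \<longrightarrow> \<not> bad Ms T s u (orc B' \<Gamma>'))"

definition cond :: "(nat \<Rightarrow> otm) \<Rightarrow> nat \<Rightarrow> bool list set \<Rightarrow> (bool list \<Rightarrow> bool list) \<Rightarrow>
    (nat \<Rightarrow> tag) \<Rightarrow> bool" where
  "cond Ms l B \<Gamma> \<tau> \<longleftrightarrow> \<tau> 0 = Unused \<and> (\<forall>s>l. \<tau> s = Unused) \<and> legal Ms (Suc l) l \<tau> B \<Gamma> \<and>
     (\<forall>s\<le>l. safe Ms s \<tau> B \<Gamma> (\<tau> s))"

lemma legal_agree_tags:
  assumes "\<And>s. s < r \<Longrightarrow> \<tau> s = \<tau>' s"
  shows "legal Ms r u \<tau> B \<Gamma> \<longleftrightarrow> legal Ms r u \<tau>' B \<Gamma>"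
  using assms unfolding legal_def by auto

lemma safe_cong:
  assumes "agree (s - 1) B \<Gamma> B' \<Gamma>'" "\<And>r. r < s \<Longrightarrow> \<tau> r = \<tau>' r"
  shows "safe Ms s \<tau> B \<Gamma> T \<longleftrightarrow> safe Ms s \<tau>' B' \<Gamma>' T"
proof -
  have "agree (s - 1) B \<Gamma> B'' \<Gamma>'' \<longleftrightarrow> agree (s - 1) B' \<Gamma>' B'' \<Gamma>''" for B'' \<Gamma>''
    using assms(1) by (auto simp: agree_def)
  then show ?thesis
    using legal_agree_tags[OF assms(2)] by (simp add: safe_def)
qed

section \<open>Canonical completions of a condition\<close>

definition next_val :: "nat \<Rightarrow> (bool list \<Rightarrow> bool list) \<Rightarrow> (nat \<Rightarrow> tag) \<Rightarrow> bool list \<Rightarrow>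
    nat set \<Rightarrow> bool list \<Rightarrow> bool list" where
  "next_val l \<Gamma>0 \<tau> d D z =
     (if length z \<le> l then \<Gamma>0 z
      else if \<exists>s x M. z = code s x \<and> \<tau> s = Fun M
      then THE y. \<exists>s x M. z = code s x \<and> \<tau> s = Fun M \<and> y = eval_word M s D x
      else d)"

lemma next_val_old: "length z \<le> l \<Longrightarrow> next_val l \<Gamma>0 \<tau> d D z = \<Gamma>0 z"
  by (simp add: next_val_def)

lemma next_val_code:
  "l < length (code s x) \<Longrightarrow> \<tau> s = Fun M \<Longrightarrow> next_val l \<Gamma>0 \<tau> d D (code s x) = eval_word M s D x"
  by (simp add: next_val_def)

lemma next_val_default:
  "l < length z \<Longrightarrow> \<nexists>s x M. z = code s x \<and> \<tau> s = Fun M \<Longrightarrow> next_val l \<Gamma>0 \<tau> d D z = d"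
  unfolding next_val_def by (simp only: if_False not_le[symmetric])

lemma next_val_agr:
  assumes "agr (length z - 1) D D'"
  shows "next_val l \<Gamma>0 \<tau> d D z = next_val l \<Gamma>0 \<tau> d D' z"
proof (cases "l < length z \<and> (\<exists>s x M. z = code s x \<and> \<tau> s = Fun M)")
  case True
  then obtain s x M where z: "z = code s x" "\<tau> s = Fun M" "l < length z" by blast
  then have "agr (bnd s (length x)) D D'"
    using agr_mono[OF assms] bnd_less_length_code[of s x] by simp
  then show ?thesis using z by (simp add: next_val_code eval_word_agr)
next
  case False
  then consider "length z \<le> l" | "l < length z" "\<nexists>s x M. z = code s x \<and> \<tau> s = Fun M"
    by fastforce
  then show ?thesis
    by cases (simp_all only: next_val_old next_val_default simp_thms)
qed

text \<open>A fixed point, because the promised values are computed with the very oracle that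
  displays them.\<close>

definition canon :: "nat \<Rightarrow> (bool list \<Rightarrow> bool list) \<Rightarrow> (nat \<Rightarrow> tag) \<Rightarrow> bool list \<Rightarrow>
    bool list set \<Rightarrow> (bool list \<Rightarrow> bool list) \<Rightarrow> bool" where
  "canon l \<Gamma>0 \<tau> d B \<Gamma> \<longleftrightarrow> (\<forall>z. \<Gamma> z = next_val l \<Gamma>0 \<tau> d (orc B \<Gamma>) z)"

text \<open>The value at \<open>z\<close> only depends on the oracle below the length of \<open>z\<close>, so iterating
  \<open>next_val\<close> stabilises at \<open>z\<close> after \<open>length z + 1\<close> rounds.\<close>

lemma canon_exists: "\<exists>\<Gamma>. canon l \<Gamma>0 \<tau> d B \<Gamma>"
proof -
  define H where "H = (\<lambda>\<Gamma>. next_val l \<Gamma>0 \<tau> d (orc B \<Gamma>))"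
  have H: "H \<Gamma> z = H \<Gamma>' z" if "\<And>z'. length z' < length z \<Longrightarrow> \<Gamma> z' = \<Gamma>' z'" for \<Gamma> \<Gamma>' z
    unfolding H_def by (rule next_val_agr, rule agr_orc_less) (use that in auto)
  have stable: "(H ^^ m) (\<lambda>_. []) z = (H ^^ n) (\<lambda>_. []) z"
    if "length z < m" "length z < n" for m n z
    using that
  proof (induction "length z" arbitrary: z m n rule: less_induct)
    case less
    obtain m' where m: "m = Suc m'" using less.prems(1) by (cases m) auto
    obtain n' where n: "n = Suc n'" using less.prems(2) by (cases n) auto
    have "H ((H ^^ m') (\<lambda>_. [])) z = H ((H ^^ n') (\<lambda>_. [])) z"
    proof (rule H)
      fix z' :: "bool list" assume "length z' < length z"
      then show "(H ^^ m') (\<lambda>_. []) z' = (H ^^ n') (\<lambda>_. []) z'"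
        using less.hyps[of z' m' n'] less.prems m n by linarith
    qed
    then show ?case by (simp add: m n)
  qed
  define \<Gamma> where "\<Gamma> = (\<lambda>z. (H ^^ Suc (length z)) (\<lambda>_. []) z)"
  have "\<Gamma> z = H \<Gamma> z" for z
  proof -
    have "\<Gamma> z = H ((H ^^ length z) (\<lambda>_. [])) z" by (simp add: \<Gamma>_def)
    also have "\<dots> = H \<Gamma> z"
    proof (rule H)
      fix z' :: "bool list" assume "length z' < length z"
      then show "(H ^^ length z) (\<lambda>_. []) z' = \<Gamma> z'"
        unfolding \<Gamma>_def by (intro stable) simp_all
    qed
    finally show ?thesis .
  qed
  then show ?thesis unfolding canon_def H_def by blast
qed

lemma canon_old: "canon l \<Gamma>0 \<tau> d B \<Gamma> \<Longrightarrow> length z \<le> l \<Longrightarrow> \<Gamma> z = \<Gamma>0 z"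
  unfolding canon_def by (metis next_val_old)

lemma canon_code:
  "canon l \<Gamma>0 \<tau> d B \<Gamma> \<Longrightarrow> l < length (code s x) \<Longrightarrow> \<tau> s = Fun M \<Longrightarrow>
    \<Gamma> (code s x) = eval_word M s (orc B \<Gamma>) x"
  unfolding canon_def by (metis next_val_code)

lemma canon_default:
  "canon l \<Gamma>0 \<tau> d B \<Gamma> \<Longrightarrow> l < length z \<Longrightarrow> \<nexists>s x M. z = code s x \<and> \<tau> s = Fun M \<Longrightarrow> \<Gamma> z = d"
  unfolding canon_def by (metis next_val_default)

lemma canon_agree:
  assumes "canon l \<Gamma>0 \<tau> d B' \<Gamma>" "\<And>w. length w \<le> l \<Longrightarrow> w \<in> B \<longleftrightarrow> w \<in> B'"
  shows "agree l B \<Gamma>0 B' \<Gamma>"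
  using assms(2) canon_old[OF assms(1)] by (auto simp: agree_def)

text \<open>Induction on the length of \<open>z\<close>: old values and the default \<open>d\<close>
  stay sound by agreement up to \<open>l\<close>, and an unsound promised value would be a violation
  excluded by \<open>safe\<close>.\<close>

lemma legal_canon:
  assumes P: "cond Ms l B \<Gamma>0 \<tau>" and B': "\<And>w. length w \<le> l \<Longrightarrow> w \<in> B \<longleftrightarrow> w \<in> B'"
    and ex: "\<And>s Ma Mb k. \<tau> s = Con Ma Mb k \<Longrightarrow> exclusive B' s"
    and d: "length d \<le> l" "nat_of_word d \<notin> K Ms (orc B \<Gamma>0)"
    and can: "canon l \<Gamma>0 \<tau> d B' \<Gamma>"
  shows "legal Ms r u \<tau> B' \<Gamma>"
proof -
  have agree: "agree l B \<Gamma>0 B' \<Gamma>" by (rule canon_agree[OF can]) (rule B')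
  note agr = agr_orc[OF agree]
  have legal: "legal Ms (Suc l) l \<tau> B \<Gamma>0" using P by (simp add: cond_def)
  have unused: "\<tau> s = Unused" if "s > l" for s using P that by (simp add: cond_def)
  have val: "\<Gamma> (code s x) = eval_word M s (orc B' \<Gamma>) x" if "\<tau> s = Fun M" for s x M
  proof (cases "length (code s x) \<le> l")
    case True
    have "s < Suc l" using unused that by (metis not_less_eq tag.distinct(1))
    then have "\<Gamma>0 (code s x) = eval_word M s (orc B \<Gamma>0) x"
      using legal True that by (simp add: legal_def)
    moreover have "eval_word M s (orc B \<Gamma>0) x = eval_word M s (orc B' \<Gamma>) x"
      by (rule eval_word_agr, rule agr_mono[OF agr])
         (rule less_imp_le[OF less_le_trans[OF bnd_less_length_code True]])
    ultimately show ?thesis using canon_old[OF can True] by simp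
  qed (use canon_code[OF can] that in simp)
  have "length (\<Gamma> z) \<le> length z \<and> nat_of_word (\<Gamma> z) \<notin> K Ms (orc B' \<Gamma>)" for z
  proof (induction "length z" arbitrary: z rule: less_induct)
    case less
    have K: "nat_of_word w \<in> K Ms (orc B \<Gamma>0) \<longleftrightarrow> nat_of_word w \<in> K Ms (orc B' \<Gamma>)"
      if "length w \<le> l" for w
      by (rule K_agr) (use agr_mono[OF agr] that in simp)
    consider (old) "length z \<le> l" | (code) s x M where "z = code s x" "\<tau> s = Fun M" "l < length z"
      | (default) "\<nexists>s x M. z = code s x \<and> \<tau> s = Fun M" "l < length z"
      by fastforce
    then show ?case
    proof cases
      case old
      then have "length (\<Gamma>0 z) \<le> length z" "nat_of_word (\<Gamma>0 z) \<notin> K Ms (orc B \<Gamma>0)"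
        using legal by (auto simp: legal_def)
      then show ?thesis using K old canon_old[OF can old] by simp
    next
      case default
      then show ?thesis using canon_default[OF can] d K by simp
    next
      case code
      \<comment> \<open>By induction the oracle is legal up to just below \<open>z\<close>, and the
        padding of \<open>code s x\<close> leaves room there for the run on \<open>x\<close>. So the
        safety of tag \<open>s\<close> applies.\<close>
      define u where "u = length z - 1"
      have s: "s \<le> l" using unused code by (metis not_less tag.distinct(1))
      have u: "l \<le> u" "bnd s (length x) \<le> u" "u < length z"
        using code bnd_less_length_code[of s x] by (auto simp: u_def)
      have "legal Ms s u \<tau> B' \<Gamma>"
        unfolding legal_def using val ex less u by auto
      moreover have "agree (s - 1) B \<Gamma>0 B' \<Gamma>" using agree_mono[OF agree] s by simp
      moreover have "safe Ms s \<tau> B \<Gamma>0 (Fun M)" using P s code by (auto simp: cond_def)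
      ultimately have "\<not> bad Ms (Fun M) s u (orc B' \<Gamma>)"
        unfolding safe_def using s u(1) le_SucI order_trans by blast
      then have "nat_of_word (\<Gamma> z) \<notin> K Ms (orc B' \<Gamma>)"
        using u val code by auto
      moreover have "length (\<Gamma> z) \<le> length z"
        using val code length_eval_word[of M s "orc B' \<Gamma>" x] u by simp
      ultimately show ?thesis by blast
    qed
  qed
  then show ?thesis
    unfolding legal_def using val ex by auto
qed

text \<open>Agreement up to \<open>u\<close> says nothing about exclusivity on high levels, which is
  assumed separately; the other clauses only concern oracle words of length at most
  \<open>u\<close>.\<close>

lemma legal_agree:
  assumes "legal Ms r u \<tau> B \<Gamma>" "agree u B \<Gamma> B' \<Gamma>'"
    "\<And>s Ma Mb k. \<tau> s = Con Ma Mb k \<Longrightarrow> exclusive B' s"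
  shows "legal Ms r u \<tau> B' \<Gamma>'"
proof -
  note agr = agr_orc[OF assms(2)]
  have \<Gamma>: "\<Gamma>' z = \<Gamma> z" if "length z \<le> u" for z using assms(2) that by (simp add: agree_def)
  have "\<Gamma>' (code s x) = eval_word M s (orc B' \<Gamma>') x"
    if "s < r" "\<tau> s = Fun M" "length (code s x) \<le> u" for s x M
  proof -
    have "eval_word M s (orc B \<Gamma>) x = eval_word M s (orc B' \<Gamma>') x"
      by (rule eval_word_agr, rule agr_mono[OF agr])
         (use that bnd_less_length_code[of s x] in linarith)
    then show ?thesis using \<Gamma> that assms(1) by (simp add: legal_def)
  qed
  moreover have "length (\<Gamma>' z) \<le> length z \<and> nat_of_word (\<Gamma>' z) \<notin> K Ms (orc B' \<Gamma>')"
    if z: "length z \<le> u" for z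
  proof -
    have l: "length (\<Gamma> z) \<le> length z" "nat_of_word (\<Gamma> z) \<notin> K Ms (orc B \<Gamma>)"
      using assms(1) z by (auto simp: legal_def)
    have "nat_of_word (\<Gamma> z) \<notin> K Ms (orc B' \<Gamma>')"
      using l(2) K_agr[OF agr_mono[OF agr]] l(1) z by simp
    then show ?thesis using l(1) \<Gamma>[OF z] by simp
  qed
  ultimately show ?thesis using assms(3) by (auto simp: legal_def)
qed

section \<open>Extending conditions\<close>

lemma safe_eq:
  assumes "cond Ms l B \<Gamma> \<tau>" "agree l B \<Gamma> B' \<Gamma>'" "s \<le> l"
  shows "safe Ms s \<tau> B' \<Gamma>' (\<tau> s)"
proof -
  have "agree (s - 1) B \<Gamma> B' \<Gamma>'" using agree_mono[OF assms(2)] assms(3) by simp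
  then show ?thesis using assms(1,3) safe_cong[of s B \<Gamma> B' \<Gamma>' \<tau> \<tau>] unfolding cond_def by blast
qed

lemma cond_extend:
  assumes P: "cond Ms l B \<Gamma> \<tau>" and agree: "agree l B \<Gamma> B' \<Gamma>'"
    and legal: "legal Ms (Suc l) u \<tau> B' \<Gamma>'" and u: "l \<le> u"
  shows "cond Ms u B' \<Gamma>' \<tau>"
proof -
  have unused: "\<tau> s = Unused" if "l < s" for s using P that by (simp add: cond_def)
  have "legal Ms (Suc u) u \<tau> B' \<Gamma>'"
    using legal unused unfolding legal_def by (metis not_less_eq tag.distinct(1,3))
  moreover have "safe Ms s \<tau> B' \<Gamma>' (\<tau> s)" for s
    using safe_eq[OF P agree] unused[of s] by (cases "s \<le> l") (auto simp: safe_def)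
  ultimately show ?thesis
    using P u by (auto simp: cond_def)
qed

lemma cond_exclusive: "cond Ms l B \<Gamma> \<tau> \<Longrightarrow> \<tau> s = Con Ma Mb k \<Longrightarrow> exclusive B s"
  unfolding cond_def legal_def by (metis not_less_eq tag.distinct(3))

text \<open>The canonical completion with default \<open>d\<close> stores \<open>d\<close> at all
  new all-zero words, as these are not codes. This will put every sound word into the range of
  \<Gamma>.\<close>

lemma cond_grow:
  assumes P: "cond Ms l B \<Gamma> \<tau>" and u: "l \<le> u"
    and d: "length d \<le> l" "nat_of_word d \<notin> K Ms (orc B \<Gamma>)"
  obtains \<Gamma>' where "cond Ms u B \<Gamma>' \<tau>" "agree l B \<Gamma> B \<Gamma>'"
    "\<And>n. l < n \<Longrightarrow> \<Gamma>' (replicate n False) = d"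
proof -
  obtain \<Gamma>' where can: "canon l \<Gamma> \<tau> d B \<Gamma>'" using canon_exists by blast
  have agree: "agree l B \<Gamma> B \<Gamma>'" by (rule canon_agree[OF can]) simp
  have "legal Ms (Suc l) u \<tau> B \<Gamma>'"
    using legal_canon[OF P _ _ d can] cond_exclusive[OF P] by blast
  then have "cond Ms u B \<Gamma>' \<tau>" by (rule cond_extend[OF P agree _ u])
  moreover have "\<Gamma>' (replicate n False) = d" if "l < n" for n
    using canon_default[OF can] code_neq_zeros that by (metis length_replicate)
  ultimately show ?thesis using that agree by blast
qed

lemma cond_new_tag:
  assumes P: "cond Ms l B \<Gamma> \<tau>" and safe: "safe Ms (Suc l) \<tau> B \<Gamma> T"
  obtains B' \<Gamma>' \<tau>' where "cond Ms (Suc l) B' \<Gamma>' \<tau>'" "agree l B \<Gamma> B' \<Gamma>'"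
    "\<And>s. s \<le> l \<Longrightarrow> \<tau>' s = \<tau> s" "\<tau>' (Suc l) = T"
proof -
  \<comment> \<open>All words of tag \<open>Suc l\<close> are longer than \<open>l\<close>, hence
    still free. Keeping one word of kind \<open>True\<close> per level makes the new tag
    exclusive.\<close>
  define B' where "B' = {w \<in> B. \<nexists>t y. w = gword t y (Suc l)} \<union>
     {gword True (replicate n False) (Suc l) | n. True}"
  have BB': "w \<in> B \<longleftrightarrow> w \<in> B'" if "length w \<le> l" for w
    using that by (auto simp: B'_def length_gword)
  have has_old: "has B' c t n = has B c t n" if "c \<le> l" for c t n
    using that by (auto simp: has_def B'_def)
  have ex_new: "exclusive B' (Suc l)"
    unfolding exclusive_def
  proof
    fix n
    have "has B' (Suc l) True n"
      unfolding has_def B'_def by (intro exI[of _ "replicate n False"]) auto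
    moreover have "\<not> has B' (Suc l) False n"
      by (auto simp: has_def B'_def)
    ultimately show "has B' (Suc l) True n \<noteq> has B' (Suc l) False n" by simp
  qed
  have unused: "\<tau> s = Unused" if "l < s" for s using P that by (simp add: cond_def)
  have ex_old: "exclusive B' s" if "\<tau> s = Con Ma Mb k" for s Ma Mb k
  proof -
    have "s \<le> l" using unused that by (metis not_less tag.distinct(3))
    then show ?thesis
      using cond_exclusive[OF P that] has_old by (simp add: exclusive_def)
  qed
  obtain \<Gamma>' where can: "canon l \<Gamma> \<tau> [] B' \<Gamma>'" using canon_exists by blast
  have agree: "agree l B \<Gamma> B' \<Gamma>'" by (rule canon_agree[OF can]) (rule BB')
  have leg: "legal Ms (Suc l) (Suc l) \<tau> B' \<Gamma>'"
    by (rule legal_canon[OF P _ _ _ _ can]) (use BB' ex_old zero_notin_K in auto)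
  have P': "cond Ms (Suc l) B' \<Gamma>' \<tau>"
    by (rule cond_extend[OF P agree leg]) simp
  define \<tau>' where "\<tau>' = \<tau>(Suc l := T)"
  have "legal Ms (Suc (Suc l)) (Suc l) \<tau>' B' \<Gamma>'"
    unfolding legal_def
  proof (intro conjI allI impI)
    \<comment> \<open>For the new tag there is nothing to check yet: \<open>code (Suc l) x\<close>
      is longer than \<open>Suc l\<close>.\<close>
    fix s M x assume "s < Suc (Suc l)" "\<tau>' s = Fun M" "length (code s x) \<le> Suc l"
    then show "\<Gamma>' (code s x) = eval_word M s (orc B' \<Gamma>') x"
      using leg by (cases "s = Suc l") (auto simp: \<tau>'_def legal_def length_code)
  next
    fix s Ma Mb k assume "s < Suc (Suc l)" "\<tau>' s = Con Ma Mb k"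
    then show "exclusive B' s"
      using ex_old ex_new by (cases "s = Suc l") (auto simp: \<tau>'_def)
  qed (use leg in \<open>auto simp: legal_def\<close>)
  moreover have "safe Ms s \<tau>' B' \<Gamma>' (\<tau>' s)" if "s \<le> Suc l" for s
  proof (cases "s = Suc l")
    case True
    then show ?thesis
      using safe safe_cong[of "Suc l" B \<Gamma> B' \<Gamma>' \<tau> \<tau>'] agree by (simp add: \<tau>'_def)
  next
    case False
    then show ?thesis
      using safe_eq[OF P agree, of s] safe_cong[of s B' \<Gamma>' B' \<Gamma>' \<tau> \<tau>'] that
      by (simp add: \<tau>'_def)
  qed
  ultimately have "cond Ms (Suc l) B' \<Gamma>' \<tau>'"
    using P unused by (auto simp: cond_def \<tau>'_def)
  then show ?thesis using that agree by (simp add: \<tau>'_def)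
qed

text \<open>If \<open>T\<close> is not safe, a legal extension violating it exists and becomes the
  next condition; otherwise the fresh tag \<open>Suc l\<close> is given to \<open>T\<close>.\<close>

lemma cond_decide:
  assumes P: "cond Ms l B \<Gamma> \<tau>"
  obtains l' B' \<Gamma>' \<tau>' where "cond Ms l' B' \<Gamma>' \<tau>'" "agree l B \<Gamma> B' \<Gamma>'" "l \<le> l'"
    "\<And>s. s \<le> l \<Longrightarrow> \<tau>' s = \<tau> s"
    "Suc l \<le> l' \<and> \<tau>' (Suc l) = T \<or> bad Ms T (Suc l) l' (orc B' \<Gamma>')"
proof (cases "safe Ms (Suc l) \<tau> B \<Gamma> T")
  case True
  then obtain B' \<Gamma>' \<tau>' where "cond Ms (Suc l) B' \<Gamma>' \<tau>'" "agree l B \<Gamma> B' \<Gamma>'"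
    "\<And>s. s \<le> l \<Longrightarrow> \<tau>' s = \<tau> s" "\<tau>' (Suc l) = T"
    using cond_new_tag[OF P] by metis
  then show ?thesis using that[of "Suc l" B' \<Gamma>' \<tau>'] by simp
next
  case False
  then obtain u B' \<Gamma>' where u: "Suc l \<le> Suc u" "agree l B \<Gamma> B' \<Gamma>'"
    "legal Ms (Suc l) u \<tau> B' \<Gamma>'" "bad Ms T (Suc l) u (orc B' \<Gamma>')"
    unfolding safe_def by auto
  then have "cond Ms u B' \<Gamma>' \<tau>" using cond_extend[OF P] by simp
  then show ?thesis using that u by auto
qed

section \<open>Diagonalisation against many-one reductions\<close>

text \<open>\<open>P\<close> holds after adding any single word to \<open>B\<close>, with at most
  \<open>n\<close> exceptions, where \<Gamma> is recomputed canonically for the enlarged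
  \<open>B\<close>.\<close>

definition stable :: "nat \<Rightarrow> (bool list \<Rightarrow> bool list) \<Rightarrow> (nat \<Rightarrow> tag) \<Rightarrow> bool list set \<Rightarrow>
    nat \<Rightarrow> (nat set \<Rightarrow> bool) \<Rightarrow> bool" where
  "stable l \<Gamma>0 \<tau> B n P \<longleftrightarrow> (\<exists>S. finite S \<and> card S \<le> n \<and>
     (\<forall>w \<Gamma>. w \<notin> S \<longrightarrow> canon l \<Gamma>0 \<tau> [] (insert w B) \<Gamma> \<longrightarrow> P (orc (insert w B) \<Gamma>)))"

text \<open>The certificate has at most \<open>n\<close> queries with at most \<open>n\<close>
  exceptions each; outside of the union of these sets all its answers persist.\<close>

lemma stable_cert_aux:
  assumes "cert n D P"
    and "\<And>v. len v \<le> n \<Longrightarrow> stable l \<Gamma>0 \<tau> B (len v) (\<lambda>D'. v \<in> D' \<longleftrightarrow> v \<in> D)"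
  shows "stable l \<Gamma>0 \<tau> B (n\<^sup>2) P"
proof -
  obtain Q where Q: "finite Q" "card Q \<le> n" "\<And>v. v \<in> Q \<Longrightarrow> len v \<le> n"
     "\<And>D'. \<forall>v\<in>Q. v \<in> D \<longleftrightarrow> v \<in> D' \<Longrightarrow> P D'"
    using assms(1) unfolding cert_def by blast
  have "\<forall>v\<in>Q. \<exists>S. finite S \<and> card S \<le> n \<and> (\<forall>w \<Gamma>. w \<notin> S \<longrightarrow>
      canon l \<Gamma>0 \<tau> [] (insert w B) \<Gamma> \<longrightarrow> (v \<in> orc (insert w B) \<Gamma> \<longleftrightarrow> v \<in> D))"
    using assms(2) Q(3) unfolding stable_def by (meson order_trans)
  then obtain S where S: "\<And>v. v \<in> Q \<Longrightarrow> finite (S v)" "\<And>v. v \<in> Q \<Longrightarrow> card (S v) \<le> n"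
    "\<And>v w \<Gamma>. v \<in> Q \<Longrightarrow> w \<notin> S v \<Longrightarrow> canon l \<Gamma>0 \<tau> [] (insert w B) \<Gamma> \<Longrightarrow>
      v \<in> orc (insert w B) \<Gamma> \<longleftrightarrow> v \<in> D"
    by metis
  show ?thesis
    unfolding stable_def
  proof (intro exI[of _ "\<Union>v\<in>Q. S v"] conjI allI impI)
    have "card (\<Union>v\<in>Q. S v) \<le> (\<Sum>v\<in>Q. card (S v))"
      by (rule card_UN_le[OF Q(1)])
    also have "\<dots> \<le> (\<Sum>v\<in>Q. n)" by (rule sum_mono) (rule S(2))
    also have "\<dots> \<le> n\<^sup>2" using Q(2) by (simp add: power2_eq_square)
    finally show "card (\<Union>v\<in>Q. S v) \<le> n\<^sup>2" .
  qed (use Q S in auto)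
qed

lemma stable_mono: "stable l \<Gamma>0 \<tau> B m P \<Longrightarrow> m \<le> n \<Longrightarrow> stable l \<Gamma>0 \<tau> B n P"
  unfolding stable_def by (meson order_trans)

text \<open>The membership of \<open>v\<close> depends on at most \<open>len v\<close> words of \<open>B\<close>: a displayed value of a
  machine of clock \<open>t\<close> depends on \<open>t\<close> queries of length at most \<open>t\<close>, hence on \<open>t\<^sup>2\<close> words,
  and \<open>t\<^sup>2\<close> is the padding of its code.\<close>

lemma stable_orc:
  assumes can: "canon l \<Gamma>0 \<tau> [] B \<Gamma>B"
  shows "stable l \<Gamma>0 \<tau> B (len v) (\<lambda>D. v \<in> D \<longleftrightarrow> v \<in> orc B \<Gamma>B)"
proof (induction "len v" arbitrary: v rule: less_induct)
  case less
  have triv: "stable l \<Gamma>0 \<tau> B (len v) (\<lambda>D. v \<in> D \<longleftrightarrow> v \<in> orc B \<Gamma>B)"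
    if "\<And>w \<Gamma>. canon l \<Gamma>0 \<tau> [] (insert w B) \<Gamma> \<Longrightarrow> v \<in> orc (insert w B) \<Gamma> \<longleftrightarrow> v \<in> orc B \<Gamma>B"
    unfolding stable_def using that by (intro exI[of _ "{}"]) auto
  show ?case
  proof (cases v rule: orc_cases)
    case (base w)
    then have v: "v = nat_of_word (w @ [False])" by (metis nat_of_word_of_nat)
    show ?thesis
      unfolding stable_def v orc_snoc_False by (intro exI[of _ "{w @ [False]}"]) auto
  next
    case none
    then show ?thesis using triv by simp
  next
    case (disp z p j b)
    then have v: "v = nat_of_word (marked (marked z p) j @ [b, True])"
      by (metis nat_of_word_of_nat)
    consider (const) "p \<noteq> 0 \<or> length z \<le> l \<or> (\<nexists>s x M. z = code s x \<and> \<tau> s = Fun M)"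
      | (code) s x M where "p = 0" "l < length z" "z = code s x" "\<tau> s = Fun M"
      by fastforce
    then show ?thesis
    proof cases
      case const
      have "\<Gamma> z = \<Gamma>B z" if "canon l \<Gamma>0 \<tau> [] (insert w B) \<Gamma>" "p = 0" for w \<Gamma>
        using const canon_old[OF can] canon_old[OF that(1)] canon_default[OF can]
          canon_default[OF that(1)] that(2) by (metis not_less)
      then show ?thesis
        by (intro triv) (auto simp: v orc_display Phi_def)
    next
      case code
      let ?n = "bnd s (length x)"
      have n: "?n < length z" "?n\<^sup>2 \<le> length z"
        using code bnd_less_length_code by (auto simp: length_code)
      have "stable l \<Gamma>0 \<tau> B (?n\<^sup>2) (\<lambda>D'. eval_word M s D' x = eval_word M s (orc B \<Gamma>B) x)"
        by (rule stable_cert_aux[OF cert_eval_word], rule less.hyps) (use v n in simp)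
      then have "stable l \<Gamma>0 \<tau> B (len v) (\<lambda>D'. eval_word M s D' x = eval_word M s (orc B \<Gamma>B) x)"
        by (rule stable_mono) (use v n in simp)
      then show ?thesis
        unfolding stable_def v orc_display Phi_def
        using code canon_code[OF can] canon_code by metis
    qed
  qed
qed

lemma stable_cert:
  assumes "canon l \<Gamma>0 \<tau> [] B \<Gamma>B" "cert n (orc B \<Gamma>B) P"
  shows "stable l \<Gamma>0 \<tau> B (n\<^sup>2) P"
  by (rule stable_cert_aux[OF assms(2) stable_orc[OF assms(1)]])

lemma stable_conj:
  assumes "stable l \<Gamma>0 \<tau> B m P" "stable l \<Gamma>0 \<tau> B n R"
  shows "stable l \<Gamma>0 \<tau> B (m + n) (\<lambda>D. P D \<and> R D)"
proof -
  obtain S where S: "finite S" "card S \<le> m"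
    "\<And>w \<Gamma>. w \<notin> S \<Longrightarrow> canon l \<Gamma>0 \<tau> [] (insert w B) \<Gamma> \<Longrightarrow> P (orc (insert w B) \<Gamma>)"
    using assms(1) unfolding stable_def by blast
  obtain T where T: "finite T" "card T \<le> n"
    "\<And>w \<Gamma>. w \<notin> T \<Longrightarrow> canon l \<Gamma>0 \<tau> [] (insert w B) \<Gamma> \<Longrightarrow> R (orc (insert w B) \<Gamma>)"
    using assms(2) unfolding stable_def by blast
  show ?thesis
    unfolding stable_def
    by (rule exI[of _ "S \<union> T"]) (use S T card_Un_le[of S T] in auto)
qed

text \<open>There are \<open>2 ^ n\<close> words of kind \<open>t\<close>, tag \<open>c\<close> and
  level \<open>n\<close>, more than there are exceptions.\<close>

lemma stable_pick:
  assumes "stable l \<Gamma>0 \<tau> B m P" "m < 2 ^ n"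
  obtains y \<Gamma> where "length y = n" "canon l \<Gamma>0 \<tau> [] (insert (gword t y c) B) \<Gamma>"
    "P (orc (insert (gword t y c) B) \<Gamma>)"
proof -
  obtain S where S: "finite S" "card S \<le> m"
    "\<And>w \<Gamma>. w \<notin> S \<Longrightarrow> canon l \<Gamma>0 \<tau> [] (insert w B) \<Gamma> \<Longrightarrow> P (orc (insert w B) \<Gamma>)"
    using assms(1) unfolding stable_def by blast
  let ?Y = "{y :: bool list. length y = n}"
  have "card ?Y = 2 ^ n"
    using card_lists_length_eq[of "UNIV :: bool set" n] by simp
  moreover have "card ((\<lambda>y. gword t y c) ` ?Y) = card ?Y"
    by (rule card_image) (auto simp: inj_on_def)
  ultimately have "\<not> (\<lambda>y. gword t y c) ` ?Y \<subseteq> S"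
    using S(1,2) assms(2) card_mono[OF S(1)] by (metis not_le order_trans)
  then obtain y where y: "length y = n" "gword t y c \<notin> S" by auto
  obtain \<Gamma> where "canon l \<Gamma>0 \<tau> [] (insert (gword t y c) B) \<Gamma>" using canon_exists by blast
  then show ?thesis using that y S(3) by blast
qed

lemma acc_agr: "agr (len q ^ k + k) D D' \<Longrightarrow> acc M k D q \<longleftrightarrow> acc M k D' q"
  unfolding acc_def by (rule accepts_within_agr)

lemma cond_diag:
  assumes P: "cond Ms l B \<Gamma> \<tau>" and c: "c \<le> l" "\<tau> c = Con Ma Mb k"
  obtains l' B' \<Gamma>' n where "cond Ms l' B' \<Gamma>' \<tau>" "agree l B \<Gamma> B' \<Gamma>'" "l \<le> l'"
    "n + c + 3 \<le> l'" "bnd s n \<le> l'" "(bnd s n) ^ k + k \<le> l'"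
    "has B' c False n \<noteq> acc Ma k (orc B' \<Gamma>') (clocked M s (orc B' \<Gamma>') (zeros n))"
proof -
  \<comment> \<open>\<open>f n\<close> is at least every length and time that matters on level
    \<open>n\<close>. Two certificates of size \<open>u = f n\<close> have at most
    \<open>2 * f n * f n\<close> exceptions, fewer than the words of the level;
    \<open>n \<ge> l\<close> keeps the level out of the fixed part.\<close>
  define f where "f = (\<lambda>n. l + (n + c + 3) + bnd s n + ((bnd s n) ^ k + k))"
  have "polyb (\<lambda>n. f n * f n + f n * f n)"
    unfolding f_def bnd_def by (intro polyb_add polyb_mult polyb_power polyb_const polyb_id)
  then obtain n where n: "l \<le> n" "f n * f n + f n * f n < 2 ^ n"
    using polyb_less_exp by blast
  define u where "u = f n"
  have u2: "u\<^sup>2 + u\<^sup>2 < 2 ^ n" using n by (simp add: u_def power2_eq_square)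
  have u: "l \<le> u" "n + c + 3 \<le> u" "bnd s n \<le> u" "(bnd s n) ^ k + k \<le> u"
    by (auto simp: u_def f_def)
  define B0 where "B0 = {w \<in> B. \<nexists>t y. w = gword t y c \<and> length y = n}"
  obtain \<Gamma>e where cane: "canon l \<Gamma> \<tau> [] B0 \<Gamma>e" using canon_exists by blast
  define De where "De = orc B0 \<Gamma>e"
  have B0: "w \<in> B \<longleftrightarrow> w \<in> B0" if "length w \<le> l" for w
    using that n(1) by (auto simp: B0_def length_gword)
  have unused: "\<tau> r = Unused" if "l < r" for r using P that by (simp add: cond_def)
  have has0: "has B0 r t m \<longleftrightarrow> has B r t m" if "r \<noteq> c \<or> m \<noteq> n" for r t m
    using that by (auto simp: has_def B0_def)
  have Bw: "w \<in> B \<longleftrightarrow> w \<in> insert (gword t y c) B0" if "length w \<le> l" "length y = n" for w t y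
    using that B0 n(1) by (auto simp: length_gword)
  have hasw: "has (insert (gword t y c) B0) r t' m \<longleftrightarrow>
      (if r = c \<and> m = n then t' = t else has B r t' m)" if "length y = n" for t y r t' m
    using that has0[of r m t'] by (auto simp: has_def B0_def)
  have exw: "exclusive (insert (gword t y c) B0) r" if "\<tau> r = Con Ma' Mb' k'" "length y = n"
    for t y r Ma' Mb' k'
    using cond_exclusive[OF P that(1)] hasw[OF that(2)] by (auto simp: exclusive_def)
  have legw: "legal Ms r v \<tau> (insert (gword t y c) B0) \<Gamma>w"
    if "length y = n" "canon l \<Gamma> \<tau> [] (insert (gword t y c) B0) \<Gamma>w" for t y \<Gamma>w r v
    by (rule legal_canon[OF P _ _ _ _ that(2)]) (use Bw exw zero_notin_K that in auto)
  have agw: "agree l B \<Gamma> (insert (gword t y c) B0) \<Gamma>w"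
    if "length y = n" "canon l \<Gamma> \<tau> [] (insert (gword t y c) B0) \<Gamma>w" for t y \<Gamma>w
    by (rule canon_agree[OF that(2)]) (use Bw that in auto)
  have age: "agree l B \<Gamma> B0 \<Gamma>e"
    by (rule canon_agree[OF cane]) (rule B0)
  \<comment> \<open>Only the tags below \<open>c\<close> are respected: the empty level
    \<open>n\<close> violates the exclusivity of \<open>c\<close> itself. The safety of
    \<open>c\<close> asks for no more.\<close>
  have lege: "legal Ms c u \<tau> B0 \<Gamma>e"
    unfolding legal_def
  proof (intro conjI allI impI)
    fix r M x assume r: "r < c" "\<tau> r = Fun M" "length (code r x) \<le> u"
    show "\<Gamma>e (code r x) = eval_word M r (orc B0 \<Gamma>e) x"
    proof (cases "length (code r x) \<le> l")
      case True
      have "\<Gamma> (code r x) = eval_word M r (orc B \<Gamma>) x"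
        using P r c(1) True by (auto simp: cond_def legal_def)
      moreover have "eval_word M r (orc B \<Gamma>) x = eval_word M r (orc B0 \<Gamma>e) x"
        by (rule eval_word_agr, rule agr_mono[OF agr_orc[OF age]])
           (rule less_imp_le[OF less_le_trans[OF bnd_less_length_code True]])
      ultimately show ?thesis using canon_old[OF cane True] by simp
    qed (use canon_code[OF cane] r in simp)
  next
    fix r Ma' Mb' k' assume "r < c" "\<tau> r = Con Ma' Mb' k'"
    then show "exclusive B0 r"
      using cond_exclusive[OF P] has0[of r] by (auto simp: exclusive_def)
  next
    fix z :: "bool list" assume z: "length z \<le> u"
    consider (old) "length z \<le> l" | (code) r x M where "z = code r x" "\<tau> r = Fun M" "l < length z"
      | (default) "\<nexists>s x M. z = code s x \<and> \<tau> s = Fun M" "l < length z"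
      by fastforce
    then have *: "length (\<Gamma>e z) \<le> length z \<and> nat_of_word (\<Gamma>e z) \<notin> K Ms (orc B0 \<Gamma>e)"
    proof cases
      case old
      then have o: "length (\<Gamma> z) \<le> length z" "nat_of_word (\<Gamma> z) \<notin> K Ms (orc B \<Gamma>)"
        using P by (auto simp: cond_def legal_def)
      have "nat_of_word (\<Gamma> z) \<notin> K Ms (orc B0 \<Gamma>e)"
        using o(2) K_agr[OF agr_mono[OF agr_orc[OF age]]] o(1) old by simp
      then show ?thesis using canon_old[OF cane old] o(1) by simp
    next
      case default
      then show ?thesis using canon_default[OF cane] zero_notin_K by simp
    next
      case code
      let ?e = "\<lambda>D. eval_word M r D x"
      have b: "bnd r (length x) < length z" using code bnd_less_length_code by simp
      have e: "\<Gamma>e z = ?e De" using code canon_code[OF cane] by (simp add: De_def)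
      have len: "length (?e De) \<le> length z" using length_eval_word[of M r De x] b by simp
      have "nat_of_word (?e De) \<notin> K Ms De"
      proof
        \<comment> \<open>The tag \<open>r\<close> may lie above \<open>c\<close>, and then its
          safety says nothing about this oracle. But the value and its membership in
          \<open>K\<close> are certified by few words, so both survive the addition of one word to
          level \<open>n\<close>, which yields a fully legal oracle.\<close>
        assume K: "nat_of_word (?e De) \<in> K Ms De"
        have "cert u De (\<lambda>D. ?e D = ?e De)"
          by (rule cert_mono[OF cert_eval_word]) (use b z in simp_all)
        moreover have "cert u De (\<lambda>D. nat_of_word (?e De) \<in> K Ms D)"
          by (rule cert_mono[OF cert_K[OF K]]) (use len z in simp_all)
        ultimately have st: "stable l \<Gamma> \<tau> B0 (u\<^sup>2 + u\<^sup>2)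
            (\<lambda>D. ?e D = ?e De \<and> nat_of_word (?e De) \<in> K Ms D)"
          unfolding De_def by (intro stable_conj stable_cert[OF cane])
        then obtain y \<Gamma>w where y: "length y = n"
          "canon l \<Gamma> \<tau> [] (insert (gword True y c) B0) \<Gamma>w"
          "?e (orc (insert (gword True y c) B0) \<Gamma>w) = ?e De"
          "nat_of_word (?e De) \<in> K Ms (orc (insert (gword True y c) B0) \<Gamma>w)"
          using stable_pick[OF st u2, where t = True and c = c] by blast
        have "\<Gamma>w z = ?e De" using canon_code[OF y(2)] code y(3) by simp
        moreover have "nat_of_word (\<Gamma>w z) \<notin> K Ms (orc (insert (gword True y c) B0) \<Gamma>w)"
          using legw[OF y(1,2), of 0 "length z"] by (simp add: legal_def)
        ultimately show False using y(4) by simp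
      qed
      then show ?thesis using e len by (simp add: De_def)
    qed
    then show "length (\<Gamma>e z) \<le> length z" "nat_of_word (\<Gamma>e z) \<notin> K Ms (orc B0 \<Gamma>e)" by auto
  qed
  have safe: "safe Ms c \<tau> B \<Gamma> (Con Ma Mb k)" using P c by (auto simp: cond_def)
  define q where "q = clocked M s De (zeros n)"
  have lq: "len q \<le> bnd s n" using len_clocked[of M s De "zeros n"] by (simp add: q_def bnd_def)
  then have qk: "len q ^ k + k \<le> u" using u(4) power_mono[OF lq, of k] by simp
  \<comment> \<open>The safety of \<open>c\<close> applies to the oracle with the empty level as
    well as to the repaired ones.\<close>
  have xor: "acc Ma k (orc B' \<Gamma>') q \<noteq> acc Mb k (orc B' \<Gamma>') q"
    if "agree l B \<Gamma> B' \<Gamma>'" "legal Ms c u \<tau> B' \<Gamma>'" for B' \<Gamma>'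
  proof -
    have "\<not> bad Ms (Con Ma Mb k) c u (orc B' \<Gamma>')"
    proof -
      have "c \<le> Suc u" "agree (c - 1) B \<Gamma> B' \<Gamma>'"
        using c(1) u(1) agree_mono[OF that(1), of "c - 1"] by auto
      then show ?thesis using safe that(2) unfolding safe_def by blast
    qed
    then show ?thesis using qk by auto
  qed
  have fq: "cert u De (\<lambda>D. clocked M s D (zeros n) = q)"
    unfolding q_def by (rule cert_mono[OF cert_clocked]) (use u in \<open>auto simp: bnd_def\<close>)
  \<comment> \<open>By \<open>xor\<close>, one of the machines accepts \<open>q\<close> although
    level \<open>n\<close> is empty; \<open>M'\<close> is that machine.\<close>
  define M' where "M' = (if acc Ma k De q then Ma else Mb)"
  have "acc M' k De q" using xor[OF age lege] by (auto simp: M'_def De_def)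
  then have "cert u De (\<lambda>D. acc M' k D q)"
    unfolding acc_def by (rule cert_mono[OF cert_accepts_within]) (rule qk)
  then have st: "stable l \<Gamma> \<tau> B0 (u\<^sup>2 + u\<^sup>2) (\<lambda>D. clocked M s D (zeros n) = q \<and> acc M' k D q)"
    using fq unfolding De_def by (intro stable_conj stable_cert[OF cane])
  then obtain y \<Gamma>w where y: "length y = n"
    "canon l \<Gamma> \<tau> [] (insert (gword (acc Ma k De q) y c) B0) \<Gamma>w"
    "clocked M s (orc (insert (gword (acc Ma k De q) y c) B0) \<Gamma>w) (zeros n) = q"
    "acc M' k (orc (insert (gword (acc Ma k De q) y c) B0) \<Gamma>w) q"
    using stable_pick[OF st u2, where t = "acc Ma k De q" and c = c] by blast
  \<comment> \<open>The new word has kind \<open>True\<close> iff \<open>Ma\<close> accepts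
    \<open>q\<close>. Since \<open>M'\<close> still accepts, \<open>xor\<close> shows that the
    answer of \<open>Ma\<close> is unchanged, and it is wrong about words of kind
    \<open>False\<close>.\<close>
  define B' where "B' = insert (gword (acc Ma k De q) y c) B0"
  note ag' = agw[OF y(1,2), folded B'_def]
  note leg' = legw[OF y(1,2), folded B'_def]
  note y = y[folded B'_def]
  have "acc Ma k (orc B' \<Gamma>w) q \<longleftrightarrow> acc Ma k De q"
    using xor[OF ag' leg'] y(4) by (auto simp: M'_def split: if_splits)
  moreover have "has B' c False n \<longleftrightarrow> \<not> acc Ma k De q"
    using hasw[OF y(1), of "acc Ma k De q" c False n] by (auto simp: B'_def)
  ultimately have "has B' c False n \<noteq> acc Ma k (orc B' \<Gamma>w) (clocked M s (orc B' \<Gamma>w) (zeros n))"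
    using y(3) by auto
  then show ?thesis
    using that[OF cond_extend[OF P ag' leg' u(1)] ag' u] by blast
qed

section \<open>The generic oracle\<close>

instance sym :: countable by countable_datatype
instance move :: countable by countable_datatype

lemma countable_machines: "countable {M :: otm. finite (delta M)}"
proof -
  define mk :: "((nat \<times> sym \<times> sym) \<times> (nat \<times> sym \<times> sym \<times> move \<times> move)) list \<times>
      nat \<times> nat \<times> nat \<times> nat \<times> nat \<Rightarrow> otm"
    where "mk = (\<lambda>(xs, a, b, c, d, e). \<lparr>delta = set xs, q_start = a, q_acc = b, q_query = c,
      q_yes = d, q_no = e\<rparr>)"
  have "M \<in> range mk" if fin: "finite (delta M)" for M
  proof -
    obtain xs where "set xs = delta M" using finite_list[OF fin] by blast
    then have "M = mk (xs, q_start M, q_acc M, q_query M, q_yes M, q_no M)"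
      by (simp add: mk_def)
    then show ?thesis by blast
  qed
  then have "{M. finite (delta M)} \<subseteq> range mk" by blast
  then show ?thesis by (rule countable_subset) simp
qed

text \<open>\<open>RFun\<close> and \<open>RPair\<close> ask for a decision about a function machine
  or a pair, \<open>RDiag c i s\<close> for an input where machine \<open>i\<close> with clock
  \<open>s\<close> fails to reduce the language of tag \<open>c\<close>, and \<open>RVal y\<close>
  for a proof of \<open>y\<close>. In \<open>RFun i k\<close> the tag must exceed \<open>k\<close>
  because it is also the clock exponent.\<close>

datatype req = RFun nat nat | RPair nat nat nat | RDiag nat nat nat | RVal nat

instance req :: countable by countable_datatype

type_synonym state = "nat \<times> bool list set \<times> (bool list \<Rightarrow> bool list) \<times> (nat \<Rightarrow> tag)"

fun ext :: "state \<Rightarrow> state \<Rightarrow> bool" where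
  "ext (l, B, \<Gamma>, \<tau>) (l', B', \<Gamma>', \<tau>') \<longleftrightarrow> l < l' \<and> agree l B \<Gamma> B' \<Gamma>' \<and> (\<forall>s\<le>l. \<tau>' s = \<tau> s)"

fun conds :: "(nat \<Rightarrow> otm) \<Rightarrow> state \<Rightarrow> bool" where
  "conds Ms (l, B, \<Gamma>, \<tau>) \<longleftrightarrow> cond Ms l B \<Gamma> \<tau>"

fun decided :: "(nat \<Rightarrow> otm) \<Rightarrow> tag \<Rightarrow> nat \<Rightarrow> state \<Rightarrow> bool" where
  "decided Ms T k (l, B, \<Gamma>, \<tau>) \<longleftrightarrow>
     (\<exists>s>k. s \<le> l \<and> \<tau> s = T \<or> bad Ms T s l (orc B \<Gamma>))"

text \<open>In \<open>RDiag\<close>, \<open>c \<le> l\<close> ensures that tag \<open>c\<close> is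
  settled. The other bounds cover the words of level \<open>n\<close>, the run of the reduction and
  the run of \<open>Ma\<close> on its output, so that the failure persists in the limit.\<close>

fun meets :: "(nat \<Rightarrow> otm) \<Rightarrow> (nat \<Rightarrow> otm) \<Rightarrow> req \<Rightarrow> state \<Rightarrow> bool" where
  "meets Ms e (RFun i k) P \<longleftrightarrow> decided Ms (Fun (e i)) k P"
| "meets Ms e (RPair i j k) P \<longleftrightarrow> decided Ms (Con (e i) (e j) k) 0 P"
| "meets Ms e (RDiag c i s) (l, B, \<Gamma>, \<tau>) \<longleftrightarrow> c \<le> l \<and> (\<forall>Ma Mb k. \<tau> c = Con Ma Mb k \<longrightarrow>
     (\<exists>n. n + c + 3 \<le> l \<and> bnd s n \<le> l \<and> (bnd s n) ^ k + k \<le> l \<and>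
       has B c False n \<noteq> acc Ma k (orc B \<Gamma>) (clocked (e i) s (orc B \<Gamma>) (zeros n))))"
| "meets Ms e (RVal y) (l, B, \<Gamma>, \<tau>) \<longleftrightarrow> len y \<le> l \<and>
     (y \<notin> K Ms (orc B \<Gamma>) \<longrightarrow> (\<exists>z. length z \<le> l \<and> \<Gamma> z = word_of_nat y))"

lemma ext_weak:
  assumes "ext P (l, B, \<Gamma>, \<tau>)" "agree l B \<Gamma> B' \<Gamma>'" "l \<le> l'" "\<And>s. s \<le> l \<Longrightarrow> \<tau>' s = \<tau> s"
  shows "ext P (l', B', \<Gamma>', \<tau>')"
  using assms by (cases P) (auto simp: agree_def)

lemma conds_grow:
  assumes "conds Ms P"
  obtains l B \<Gamma> \<tau> where "ext P (l, B, \<Gamma>, \<tau>)" "cond Ms l B \<Gamma> \<tau>" "m \<le> l"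
proof -
  obtain l B \<Gamma> \<tau> where P: "P = (l, B, \<Gamma>, \<tau>)" by (metis prod_cases4)
  then have c: "cond Ms l B \<Gamma> \<tau>" using assms by simp
  have "nat_of_word [] \<notin> K Ms (orc B \<Gamma>)" using zero_notin_K by simp
  then obtain \<Gamma>' where "cond Ms (Suc l + m) B \<Gamma>' \<tau>" "agree l B \<Gamma> B \<Gamma>'"
    using cond_grow[OF c, of "Suc l + m" "[]"] by auto
  then show ?thesis using that[of "Suc l + m" B \<Gamma>' \<tau>] P by simp
qed

lemma decided_dense:
  assumes "conds Ms P"
  shows "\<exists>Q. conds Ms Q \<and> ext P Q \<and> decided Ms T k Q"
proof -
  obtain l B \<Gamma> \<tau> where Q: "ext P (l, B, \<Gamma>, \<tau>)" "cond Ms l B \<Gamma> \<tau>" "k \<le> l"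
    using conds_grow[OF assms] by metis
  obtain l' B' \<Gamma>' \<tau>' where R: "cond Ms l' B' \<Gamma>' \<tau>'" "agree l B \<Gamma> B' \<Gamma>'" "l \<le> l'"
    "\<And>s. s \<le> l \<Longrightarrow> \<tau>' s = \<tau> s"
    "Suc l \<le> l' \<and> \<tau>' (Suc l) = T \<or> bad Ms T (Suc l) l' (orc B' \<Gamma>')"
    using cond_decide[OF Q(2), where T = T] by blast
  have "decided Ms T k (l', B', \<Gamma>', \<tau>')"
    using R(5) Q(3) by (auto intro!: exI[of _ "Suc l"])
  then show ?thesis using R(1) ext_weak[OF Q(1) R(2-4)] by (metis conds.simps)
qed

lemma meets_dense:
  assumes "conds Ms P"
  shows "\<exists>Q. conds Ms Q \<and> ext P Q \<and> meets Ms e r Q"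
proof (cases r)
  case (RFun i k)
  then show ?thesis
    using decided_dense[OF assms, of "Fun (e i)" k] by (simp only: meets.simps)
next
  case (RPair i j k)
  then show ?thesis
    using decided_dense[OF assms, of "Con (e i) (e j) k" 0] by (simp only: meets.simps)
next
  case (RDiag c i s)
  obtain l B \<Gamma> \<tau> where Q: "ext P (l, B, \<Gamma>, \<tau>)" "cond Ms l B \<Gamma> \<tau>" "c \<le> l"
    using conds_grow[OF assms] by metis
  show ?thesis
  proof (cases "\<exists>Ma Mb k. \<tau> c = Con Ma Mb k")
    case True
    then obtain Ma Mb k where t: "\<tau> c = Con Ma Mb k" by blast
    obtain l' B' \<Gamma>' n where R: "cond Ms l' B' \<Gamma>' \<tau>" "agree l B \<Gamma> B' \<Gamma>'" "l \<le> l'"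
      "n + c + 3 \<le> l'" "bnd s n \<le> l'" "(bnd s n) ^ k + k \<le> l'"
      "has B' c False n \<noteq> acc Ma k (orc B' \<Gamma>') (clocked (e i) s (orc B' \<Gamma>') (zeros n))"
      using cond_diag[OF Q(2,3) t, where s = s and M = "e i"] by blast
    have "ext P (l', B', \<Gamma>', \<tau>)" by (rule ext_weak[OF Q(1) R(2,3)]) simp
    moreover have "meets Ms e (RDiag c i s) (l', B', \<Gamma>', \<tau>)"
      using R Q(3) t by auto
    ultimately show ?thesis using R(1) RDiag by (metis conds.simps)
  next
    case False
    then have "meets Ms e (RDiag c i s) (l, B, \<Gamma>, \<tau>)" using Q(3) by auto
    then show ?thesis using Q RDiag by (metis conds.simps)
  qed
next
  case (RVal y)
  obtain l B \<Gamma> \<tau> where Q: "ext P (l, B, \<Gamma>, \<tau>)" "cond Ms l B \<Gamma> \<tau>" "len y \<le> l"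
    using conds_grow[OF assms] by metis
  show ?thesis
  proof (cases "y \<in> K Ms (orc B \<Gamma>)")
    case True
    then have "meets Ms e (RVal y) (l, B, \<Gamma>, \<tau>)" using Q(3) by simp
    then show ?thesis using Q RVal by (metis conds.simps)
  next
    case False
    then obtain \<Gamma>' where R: "cond Ms (Suc l) B \<Gamma>' \<tau>" "agree l B \<Gamma> B \<Gamma>'"
      "\<And>n. l < n \<Longrightarrow> \<Gamma>' (replicate n False) = word_of_nat y"
      using cond_grow[OF Q(2), of "Suc l" "word_of_nat y"] Q(3) by auto
    have "ext P (Suc l, B, \<Gamma>', \<tau>)" by (rule ext_weak[OF Q(1) R(2)]) auto
    moreover have "meets Ms e (RVal y) (Suc l, B, \<Gamma>', \<tau>)"
      using R(3)[of "Suc l"] Q(3) by (auto intro!: exI[of _ "replicate (Suc l) False"])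
    ultimately show ?thesis using R(1) RVal by (metis conds.simps)
  qed
qed

lemma generic_exists:
  obtains B \<Gamma> where
    "\<And>z. length (\<Gamma> z) \<le> length z"
    "range (\<lambda>z. nat_of_word (\<Gamma> z)) = - K Ms (orc B \<Gamma>)"
    "\<And>M k. finite (delta M) \<Longrightarrow> \<exists>s>k. (\<forall>x. \<Gamma> (code s x) = eval_word M s (orc B \<Gamma>) x) \<or>
        (\<exists>x. nat_of_word (eval_word M s (orc B \<Gamma>) x) \<in> K Ms (orc B \<Gamma>))"
    "\<And>Ma Mb k. finite (delta Ma) \<Longrightarrow> finite (delta Mb) \<Longrightarrow>
       (\<forall>q. acc Ma k (orc B \<Gamma>) q \<noteq> acc Mb k (orc B \<Gamma>) q) \<Longrightarrow>
       \<exists>c. exclusive B c \<and> (\<forall>M s. finite (delta M) \<longrightarrow>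
         (\<exists>n. has B c False n \<noteq> acc Ma k (orc B \<Gamma>) (clocked M s (orc B \<Gamma>) (zeros n))))"
proof -
  define e where "e = from_nat_into {M :: otm. finite (delta M)}"
  have e: "\<exists>i. e i = M" if "finite (delta M)" for M
  proof -
    have "from_nat_into {M :: otm. finite (delta M)} (to_nat_on {M. finite (delta M)} M) = M"
      by (rule from_nat_into_to_nat_on[OF countable_machines]) (use that in simp)
    then show ?thesis unfolding e_def by blast
  qed
  \<comment> \<open>\<open>from_nat\<close> runs through all requests, and stage
    \<open>Suc n\<close> meets the one with number \<open>n\<close>.\<close>
  have "\<exists>P. \<forall>n. conds Ms (P n) \<and>
      (ext (P n) (P (Suc n)) \<and> meets Ms e (from_nat n) (P (Suc n)))"
  proof (rule dependent_nat_choice)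
    have "cond Ms 0 {} (\<lambda>_. []) (\<lambda>_. Unused)"
      by (auto simp: cond_def legal_def safe_def zero_notin_K)
    then show "\<exists>P. conds Ms P" by (metis conds.simps)
  qed (use meets_dense in blast)
  then obtain P where P: "\<And>n. conds Ms (P n)" "\<And>n. ext (P n) (P (Suc n))"
    "\<And>n. meets Ms e (from_nat n) (P (Suc n))" by blast
  define l where "l = (\<lambda>n. fst (P n))"
  define Bs where "Bs = (\<lambda>n. fst (snd (P n)))"
  define Gs where "Gs = (\<lambda>n. fst (snd (snd (P n))))"
  define ts where "ts = (\<lambda>n. snd (snd (snd (P n))))"
  have Pn: "P n = (l n, Bs n, Gs n, ts n)" for n by (simp add: l_def Bs_def Gs_def ts_def)
  have cond: "cond Ms (l n) (Bs n) (Gs n) (ts n)" for n using P(1)[of n] Pn[of n] by simp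
  have step: "l n < l (Suc n)" "agree (l n) (Bs n) (Gs n) (Bs (Suc n)) (Gs (Suc n))"
    "s \<le> l n \<Longrightarrow> ts (Suc n) s = ts n s" for n s
    using P(2)[of n] Pn[of n] Pn[of "Suc n"] by auto
  have ln: "n \<le> l n" for n
  proof (induction n)
    case (Suc n)
    then show ?case using step(1)[of n] by linarith
  qed simp
  have mono: "l m \<le> l n \<and> agree (l m) (Bs m) (Gs m) (Bs n) (Gs n) \<and> (\<forall>s\<le>l m. ts n s = ts m s)"
    if "m \<le> n" for m n
    using that
  proof (induction n rule: dec_induct)
    case (step n)
    note s = \<open>\<And>n. l n < l (Suc n)\<close>[of n] \<open>\<And>n. agree (l n) (Bs n) (Gs n) (Bs (Suc n)) (Gs (Suc n))\<close>[of n]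
    have "agree (l m) (Bs n) (Gs n) (Bs (Suc n)) (Gs (Suc n))"
      by (rule agree_mono[OF s(2)]) (use step in simp)
    then show ?case
      using step s(1) agree_trans \<open>\<And>n s. s \<le> l n \<Longrightarrow> ts (Suc n) s = ts n s\<close> by (auto intro: agree_trans)
  qed simp
  \<comment> \<open>The limit of the stages: since \<open>n \<le> l n\<close>, stage
    \<open>length w\<close> has already fixed what concerns \<open>w\<close>.\<close>
  define B where "B = {w. w \<in> Bs (length w)}"
  define \<Gamma> where "\<Gamma> = (\<lambda>z. Gs (length z) z)"
  define D where "D = orc B \<Gamma>"
  have ag: "agree (l n) (Bs n) (Gs n) B \<Gamma>" for n
    unfolding agree_def
  proof (intro allI impI)
    fix w :: "bool list" assume w: "length w \<le> l n"
    have "(w \<in> Bs n \<longleftrightarrow> w \<in> Bs (length w)) \<and> Gs n w = Gs (length w) w"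
    proof (cases "n \<le> length w")
      case True
      then show ?thesis using mono[OF True] w by (simp add: agree_def)
    next
      case False
      then have "agree (l (length w)) (Bs (length w)) (Gs (length w)) (Bs n) (Gs n)"
        using mono by simp
      then show ?thesis using ln[of "length w"] by (simp add: agree_def)
    qed
    then show "(w \<in> Bs n \<longleftrightarrow> w \<in> B) \<and> Gs n w = \<Gamma> w" by (simp add: B_def \<Gamma>_def)
  qed
  have agr: "agr (l n) (orc (Bs n) (Gs n)) D" for n
    unfolding D_def by (rule agr_orc[OF ag])
  have tag: "ts n s = ts m s" if "s \<le> l m" "m \<le> n" for m n s using mono that by blast
  have excl: "exclusive B c" if c: "ts m c = Con Ma Mb k" for m c Ma Mb k
    unfolding exclusive_def
  proof
    fix i
    have "c \<le> l m" using cond[of m] c unfolding cond_def by (metis not_less tag.distinct(3))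
    \<comment> \<open>Exclusivity concerns infinitely many levels, so each level \<open>i\<close> is
      read off a stage that covers its words, which have length \<open>i + c + 3\<close>.\<close>
    define n where "n = m + i + c + 3"
    have n: "i + c + 3 \<le> l n" using ln[of n] by (simp add: n_def)
    have "ts n c = Con Ma Mb k" using tag[OF \<open>c \<le> l m\<close>, of n] c by (simp add: n_def)
    then have "has (Bs n) c True i \<noteq> has (Bs n) c False i"
      using cond_exclusive[OF cond] unfolding exclusive_def by blast
    moreover have "has (Bs n) c t i \<longleftrightarrow> has B c t i" for t
    proof -
      have "gword t y c \<in> Bs n \<longleftrightarrow> gword t y c \<in> B" if "length y = i" for y
        using ag[of n] n that by (simp add: agree_def length_gword)
      then show ?thesis by (auto simp: has_def)
    qed
    ultimately show "has B c True i \<noteq> has B c False i" by simp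
  qed
  have legal: "legal Ms (Suc (l n)) (l n) (ts n) B \<Gamma>" for n
  proof (rule legal_agree[OF _ ag])
    show "legal Ms (Suc (l n)) (l n) (ts n) (Bs n) (Gs n)" using cond[of n] by (simp add: cond_def)
  qed (rule excl)
  have len\<Gamma>: "length (\<Gamma> z) \<le> length z" and sound: "nat_of_word (\<Gamma> z) \<notin> K Ms D" for z
    using legal[of "length z"] ln[of "length z"] by (auto simp: legal_def D_def)
  have fresh: "\<exists>n. meets Ms e r (l n, Bs n, Gs n, ts n)" for r
    using P(3)[of "to_nat r"] Pn by (metis from_nat_to_nat)
  have full: "\<exists>z. nat_of_word (\<Gamma> z) = y" if y: "y \<notin> K Ms D" for y
  proof -
    obtain n where n: "len y \<le> l n"
      "y \<notin> K Ms (orc (Bs n) (Gs n)) \<longrightarrow> (\<exists>z. length z \<le> l n \<and> Gs n z = word_of_nat y)"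
      using fresh[of "RVal y"] by auto
    have "y \<notin> K Ms (orc (Bs n) (Gs n))" using K_agr[OF agr_mono[OF agr n(1)]] y by simp
    then obtain z where "length z \<le> l n" "Gs n z = word_of_nat y" using n(2) by blast
    then have "\<Gamma> z = word_of_nat y" using ag[of n] by (simp add: agree_def)
    then show ?thesis by (metis nat_of_word_of_nat)
  qed
  have dec: "\<exists>s>k. (\<exists>m. s \<le> l m \<and> ts m s = T) \<or> (\<exists>u. bad Ms T s u D)"
    if "decided Ms T k (l n, Bs n, Gs n, ts n)" for T k n
    using that bad_agr[OF agr] by fastforce
  show ?thesis
  proof (rule that[of \<Gamma> B, folded D_def])
    show "length (\<Gamma> z) \<le> length z" for z by (rule len\<Gamma>)
    show "range (\<lambda>z. nat_of_word (\<Gamma> z)) = - K Ms D" using sound full by (auto simp: image_iff) metis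
  next
    fix M :: otm and k assume "finite (delta M)"
    then obtain i where i: "e i = M" using e by blast
    obtain n where "decided Ms (Fun M) k (l n, Bs n, Gs n, ts n)"
      using fresh[of "RFun i k"] unfolding meets.simps i by blast
    then obtain s where s: "s > k"
      "(\<exists>m. s \<le> l m \<and> ts m s = Fun M) \<or> (\<exists>u. bad Ms (Fun M) s u D)"
      using dec by blast
    have "\<Gamma> (code s x) = eval_word M s D x" if m: "s \<le> l m" "ts m s = Fun M" for x m
    proof -
      define n where "n = m + length (code s x)"
      have "ts n s = Fun M" "s \<le> l n" "length (code s x) \<le> l n"
        using tag[OF m(1), of n] m mono[of m n] ln[of n] by (auto simp: n_def)
      then show ?thesis using legal[of n] by (auto simp: legal_def D_def)
    qed
    then show "\<exists>s>k. (\<forall>x. \<Gamma> (code s x) = eval_word M s D x) \<or>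
        (\<exists>x. nat_of_word (eval_word M s D x) \<in> K Ms D)"
      using s by auto
  next
    fix Ma Mb :: otm and k
    assume fin: "finite (delta Ma)" "finite (delta Mb)"
      and xor: "\<forall>q. acc Ma k D q \<noteq> acc Mb k D q"
    obtain i where i: "e i = Ma" using e fin(1) by blast
    obtain j where j: "e j = Mb" using e fin(2) by blast
    obtain n where "decided Ms (Con Ma Mb k) 0 (l n, Bs n, Gs n, ts n)"
      using fresh[of "RPair i j k"] unfolding meets.simps i j by blast
    then obtain c m where c: "c \<le> l m" "ts m c = Con Ma Mb k"
    proof -
      have "\<not> bad Ms (Con Ma Mb k) c u D" for c u using xor by simp
      then show ?thesis using dec[OF \<open>decided Ms (Con Ma Mb k) 0 _\<close>] that by blast
    qed
    have "\<exists>n. has B c False n \<noteq> acc Ma k D (clocked M s D (zeros n))"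
      if fM: "finite (delta M)" for M s
    proof -
      obtain f where f: "e f = M" using e fM by blast
      obtain n where n: "meets Ms e (RDiag c f s) (l n, Bs n, Gs n, ts n)" using fresh by blast
      \<comment> \<open>Stage \<open>n\<close> may come before or after stage \<open>m\<close>. As
        \<open>c\<close> is within the length of both, they give it the same tag.\<close>
      then have "c \<le> l n" by simp
      then have "ts n c = Con Ma Mb k"
        using c tag[OF c(1), of n] tag[OF \<open>c \<le> l n\<close>, of m] by (metis nle_le)
      then obtain h where h: "h + c + 3 \<le> l n" "bnd s h \<le> l n" "(bnd s h) ^ k + k \<le> l n"
        "has (Bs n) c False h \<noteq>
           acc Ma k (orc (Bs n) (Gs n)) (clocked M s (orc (Bs n) (Gs n)) (zeros h))"
        using n f by auto
      have "has (Bs n) c False h \<longleftrightarrow> has B c False h"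
      proof -
        have "gword False y c \<in> Bs n \<longleftrightarrow> gword False y c \<in> B" if "length y = h" for y
          using ag[of n] h(1) that by (simp add: agree_def length_gword)
        then show ?thesis by (auto simp: has_def)
      qed
      moreover have cl: "clocked M s (orc (Bs n) (Gs n)) (zeros h) = clocked M s D (zeros h)"
        by (rule clocked_agr, rule agr_mono[OF agr]) (use h(2) in \<open>simp add: bnd_def\<close>)
      moreover have "acc Ma k (orc (Bs n) (Gs n)) q \<longleftrightarrow> acc Ma k D q" if "len q \<le> bnd s h" for q
        by (rule acc_agr, rule agr_mono[OF agr[of n]])
           (use h(3) power_mono[OF that, of k] in linarith)
      moreover have "len (clocked M s D (zeros h)) \<le> bnd s h"
        using len_clocked[of M s D "zeros h"] by (simp add: bnd_def)
      ultimately have "has B c False h \<noteq> acc Ma k D (clocked M s D (zeros h))"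
        using h(4) by simp
      then show ?thesis by blast
    qed
    then show "\<exists>c. exclusive B c \<and> (\<forall>M s. finite (delta M) \<longrightarrow>
         (\<exists>n. has B c False n \<noteq> acc Ma k D (clocked M s D (zeros n))))"
      using excl[OF c(2)] by blast
  qed
qed

section \<open>Running machines\<close>

definition tp :: "sym list \<Rightarrow> nat \<Rightarrow> sym" where
  "tp xs i = (if i < length xs then xs ! i else Bk)"

definition bs :: "bool list \<Rightarrow> sym list" where
  "bs w = map (\<lambda>b. if b then B1 else B0) w"

text \<open>\<open>l\<close> is the work tape left of the head and \<open>r\<close> starts under the
  head; the query head stands behind \<open>q\<close>.\<close>

definition cf :: "nat \<Rightarrow> sym list \<Rightarrow> sym list \<Rightarrow> sym list \<Rightarrow> config" where
  "cf s l r q = Config s (tp (l @ r)) (length l) (tp q) (length q)"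

fun rd :: "sym list \<Rightarrow> sym" where
  "rd [] = Bk"
| "rd (a # r) = a"

lemma bs_simps [simp]:
  "bs [] = []" "bs (b # w) = (if b then B1 else B0) # bs w" "bs (v @ w) = bs v @ bs w"
  "length (bs w) = length w" "Bk \<notin> set (bs w)" "bs (replicate n False) = replicate n B0"
  by (auto simp: bs_def)

lemma tp_upd: "(tp (l @ r))(length l := a) = tp (l @ a # tl r)"
  by (cases r) (auto simp: tp_def fun_eq_iff nth_append nth_Cons')

lemma tp_snoc: "(tp q)(length q := b) = tp (q @ [b])"
  using tp_upd[of q "[]"] by simp

lemma tp_snoc_Bk: "tp (q @ [Bk]) = tp q"
  by (auto simp: tp_def fun_eq_iff nth_append)

lemma tp_rd: "tp (l @ r) (length l) = rd r"
  by (cases r) (auto simp: tp_def)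

lemma tp_end: "tp q (length q) = Bk"
  by (simp add: tp_def)

lemma tape_word_tp: "tape_word (tp (bs w @ Bk # r)) = w"
proof -
  have "(LEAST k. tp (bs w @ Bk # r) k = Bk) = length w"
  proof (rule Least_equality)
    show "tp (bs w @ Bk # r) (length w) = Bk" using tp_rd[of "bs w" "Bk # r"] by simp
  next
    fix k assume k: "tp (bs w @ Bk # r) k = Bk"
    show "length w \<le> k"
    proof (rule ccontr)
      assume "\<not> length w \<le> k"
      then show False using k by (simp add: tp_def nth_append bs_def split: if_splits)
    qed
  qed
  then show ?thesis
    by (auto simp: tape_word_def tp_def nth_append bs_def intro!: nth_equalityI)
qed

lemma tape_word_bs: "tape_word (tp (bs w)) = w"
  using tape_word_tp[of w "[]"] by (simp add: tp_snoc_Bk)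

lemma init_cf: "init M x = cf (q_start M) [] (bs (word_of_nat x)) []"
  by (auto simp: init_def cf_def tp_def bs_def fun_eq_iff)

lemma step_cf:
  assumes "s \<noteq> q_acc M" "s \<noteq> q_query M"
  shows "step M D (cf s l r q) c \<longleftrightarrow> (\<exists>s' a b m1 m2. ((s, rd r, Bk), (s', a, b, m1, m2)) \<in> delta M \<and>
    c = Config s' (tp (l @ a # tl r)) (mv m1 (length l)) (tp (q @ [b])) (mv m2 (length q)))"
  using assms by (simp add: step_def cf_def tp_rd tp_end tp_upd tp_snoc)

lemma step_query:
  assumes "q_query M \<noteq> q_acc M"
  shows "step M D (cf (q_query M) l r (bs w)) c \<longleftrightarrow>
    c = cf (if nat_of_word w \<in> D then q_yes M else q_no M) l r []"
  using assms by (simp add: step_def cf_def tape_word_bs) (auto simp: tp_def fun_eq_iff)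

lemma cf_write_right:
  "Config s (tp (l @ a # tl r)) (mv MoveR (length l)) (tp (q @ [Bk])) (mv MoveS (length q)) =
   cf s (l @ [a]) (tl r) q"
  by (simp add: cf_def tp_snoc_Bk)

lemma cf_write_left:
  "Config s (tp ((l @ [x]) @ a # r)) (mv MoveL (length (l @ [x]))) (tp (q @ [Bk]))
     (mv MoveS (length q)) = cf s l (x # a # r) q"
  by (simp add: cf_def tp_snoc_Bk)

definition runs :: "otm \<Rightarrow> nat set \<Rightarrow> nat \<Rightarrow> config \<Rightarrow> config \<Rightarrow> bool" where
  "runs M D k c c' \<longleftrightarrow> (\<exists>n\<le>k. (step M D ^^ n) c c')"

lemma runs_refl: "runs M D k c c"
  unfolding runs_def by (intro exI[of _ 0]) simp

lemma runs_step: "step M D c c' \<Longrightarrow> runs M D 1 c c'"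
  unfolding runs_def by (intro exI[of _ 1]) auto

lemma runs_trans: "runs M D a c c' \<Longrightarrow> runs M D b c' c'' \<Longrightarrow> runs M D (a + b) c c''"
  unfolding runs_def by (meson add_mono relpowp_trans)

lemma runs_mono: "runs M D a c c' \<Longrightarrow> a \<le> b \<Longrightarrow> runs M D b c c'"
  unfolding runs_def by (meson order_trans)

lemma runs_Cons: "step M D c c' \<Longrightarrow> runs M D b c' c'' \<Longrightarrow> runs M D (Suc b) c c''"
  using runs_trans[OF runs_step] by fastforce

lemma UNIV_sym: "(UNIV :: sym set) = {Bk, B0, B1}"
  using sym.exhaust by auto

lemma UNIV_move: "(UNIV :: move set) = {MoveL, MoveR, MoveS}"
  using move.exhaust by auto

lemma finite_delta:
  assumes "\<And>q a b q' a' b' m1 m2. ((q, a, b), (q', a', b', m1, m2)) \<in> R \<Longrightarrow> q \<le> n \<and> q' \<le> n"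
  shows "finite (R :: ((nat \<times> sym \<times> sym) \<times> (nat \<times> sym \<times> sym \<times> move \<times> move)) set)"
proof (rule finite_subset)
  show "R \<subseteq> ({..n} \<times> UNIV \<times> UNIV) \<times> ({..n} \<times> UNIV \<times> UNIV \<times> UNIV \<times> UNIV)"
    using assms by auto
qed (simp add: UNIV_sym UNIV_move)

section \<open>A machine printing an oracle-encoded function\<close>

fun cs :: "sym \<Rightarrow> nat" where
  "cs Bk = 0" | "cs B0 = 1" | "cs B1 = 2"

fun sy :: "nat \<Rightarrow> sym" where
  "sy 0 = Bk" | "sy (Suc 0) = B0" | "sy (Suc (Suc n)) = B1"

lemma sy_cs [simp]: "sy (cs a) = a"
  by (cases a) (auto simp: numeral_2_eq_2)

text \<open>With \<open>j\<close> bits \<open>y\<close> of the output printed, the work tape holds \<open>y\<close>, a blank, and the word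
  \<open>marked (marked z p) j\<close> followed by the kind of the next query.  States 0--2 and from 15 on
  produce this layout from the input \<open>z\<close>, state 3 rewinds to the blank, state 4 copies the word
  to the query tape, states 8 and 9 replace the blank by the next output bit and states 10--13
  shift the word by one cell and append a zero to it.  The index of a shifting state encodes
  the symbol that is carried to the right.\<close>

definition ptrans :: "nat \<Rightarrow> nat \<Rightarrow> sym \<Rightarrow> (nat \<times> sym \<times> sym \<times> move \<times> move) option" where
  "ptrans p q a =
    (if q \<le> 2 then Some (if a = Bk then 15 else cs a, sy q, Bk, MoveR, MoveS)
     else if q = 3 then (if a = Bk then Some (4, Bk, Bk, MoveR, MoveS) else Some (3, a, Bk, MoveL, MoveS))
     else if q = 4 then (if a = Bk then Some (5, Bk, B1, MoveL, MoveR) else Some (4, a, a, MoveR, MoveR))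
     else if q = 6 then Some (if a = B1 then 9 else 3, B1, Bk, MoveL, MoveS)
     else if q = 7 then (if a = B1 then Some (8, B1, Bk, MoveL, MoveS) else None)
     else if q = 8 \<or> q = 9 then
       (if a = Bk then Some (10, if q = 8 then B0 else B1, Bk, MoveR, MoveS) else Some (q, a, Bk, MoveL, MoveS))
     else if 10 \<le> q \<and> q \<le> 12 then
       (if a = Bk then Some (13, B0, Bk, MoveR, MoveS) else Some (10 + cs a, sy (q - 10), Bk, MoveR, MoveS))
     else if q = 13 \<or> q = 17 + p then Some (3, B0, Bk, MoveL, MoveS)
     else if q = 15 \<or> q = 16 + p then Some (Suc q, B1, Bk, MoveR, MoveS)
     else if 16 \<le> q \<and> q < 16 + p then Some (Suc q, B0, Bk, MoveR, MoveS)
     else None)"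

definition printer :: "nat \<Rightarrow> otm" where
  "printer p = \<lparr>delta = {((q, a, b), v). ptrans p q a = Some v},
     q_start = 0, q_acc = 14, q_query = 5, q_yes = 6, q_no = 7\<rparr>"

lemma printer_simps [simp]:
  "q_start (printer p) = 0" "q_acc (printer p) = 14" "q_query (printer p) = 5"
  "q_yes (printer p) = 6" "q_no (printer p) = 7"
  "((q, a, b), v) \<in> delta (printer p) \<longleftrightarrow> ptrans p q a = Some v"
  by (auto simp: printer_def)

lemma finite_printer: "finite (delta (printer p))"
proof (rule finite_subset)
  have "ptrans p q a = None" if "17 + p < q" for q a
    using that by (simp add: ptrans_def)
  then have "q \<le> 17 + p" if "ptrans p q a = Some v" for q a v
    using that by (metis not_less option.distinct(1))
  then show "delta (printer p) \<subseteq>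
      (\<lambda>k. (k, the (ptrans p (fst k) (fst (snd k))))) ` ({..17 + p} \<times> UNIV \<times> UNIV)"
    by (force simp: printer_def image_iff)
qed (simp add: UNIV_sym)

lemma deterministic_printer: "deterministic (printer p)"
  by (auto simp: deterministic_def printer_def)

lemma ptrans_simps [simp]:
  "ptrans p (cs c) a = Some (if a = Bk then 15 else cs a, c, Bk, MoveR, MoveS)"
  "ptrans p 3 a = (if a = Bk then Some (4, Bk, Bk, MoveR, MoveS) else Some (3, a, Bk, MoveL, MoveS))"
  "ptrans p 4 a = (if a = Bk then Some (5, Bk, B1, MoveL, MoveR) else Some (4, a, a, MoveR, MoveR))"
  "ptrans p 6 a = Some (if a = B1 then 9 else 3, B1, Bk, MoveL, MoveS)"
  "ptrans p 7 a = (if a = B1 then Some (8, B1, Bk, MoveL, MoveS) else None)"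
  "ptrans p 8 a = (if a = Bk then Some (10, B0, Bk, MoveR, MoveS) else Some (8, a, Bk, MoveL, MoveS))"
  "ptrans p 9 a = (if a = Bk then Some (10, B1, Bk, MoveR, MoveS) else Some (9, a, Bk, MoveL, MoveS))"
  "ptrans p (10 + cs c) a = (if a = Bk then Some (13, B0, Bk, MoveR, MoveS)
     else Some (10 + cs a, c, Bk, MoveR, MoveS))"
  "ptrans p 13 a = Some (3, B0, Bk, MoveL, MoveS)"
  "ptrans p 15 a = Some (16, B1, Bk, MoveR, MoveS)"
  "k < p \<Longrightarrow> ptrans p (16 + k) a = Some (Suc (16 + k), B0, Bk, MoveR, MoveS)"
  "ptrans p (16 + p) a = Some (17 + p, B1, Bk, MoveR, MoveS)"
  "ptrans p (17 + p) a = Some (3, B0, Bk, MoveL, MoveS)"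
  by (cases c; simp add: ptrans_def numeral_2_eq_2)+

lemma cs_neq [simp]: "cs a \<noteq> 5" "cs a \<noteq> 14" "10 + cs a \<noteq> 5" "10 + cs a \<noteq> 14"
  by (cases a; simp)+

lemma printer_right:
  assumes "ptrans p s (rd r) = Some (s', a, Bk, MoveR, MoveS)" "s \<noteq> 5" "s \<noteq> 14"
  shows "step (printer p) D (cf s l r q) (cf s' (l @ [a]) (tl r) q)"
  using assms by (subst step_cf) (simp_all add: cf_write_right[symmetric])

lemma printer_left:
  assumes "ptrans p s (rd r) = Some (s', a, Bk, MoveL, MoveS)" "s \<noteq> 5" "s \<noteq> 14"
  shows "step (printer p) D (cf s (l @ [x]) r q) (cf s' l (x # a # tl r) q)"
  using assms by (subst step_cf) (simp_all add: cf_write_left[symmetric])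

text \<open>State \<open>cs a\<close> carries the symbol \<open>a\<close>. Started with
  \<open>a = Bk\<close>, this shifts the input by one cell and leaves the separating blank in front
  of it.\<close>

lemma printer_init:
  "Bk \<notin> set z \<Longrightarrow> runs (printer p) D (Suc (length z)) (cf (cs a) l z []) (cf 15 (l @ a # z) [] [])"
proof (induction z arbitrary: a l)
  case Nil
  have "step (printer p) D (cf (cs a) l [] []) (cf 15 (l @ [a]) [] [])"
    using printer_right[of p "cs a" "[]" 15 a D l "[]"] by simp
  then show ?case using runs_step by fastforce
next
  case (Cons b z)
  have nb: "b \<noteq> Bk" "Bk \<notin> set z" using Cons.prems by auto
  have st: "step (printer p) D (cf (cs a) l (b # z) []) (cf (cs b) (l @ [a]) z [])"
    using printer_right[of p "cs a" "b # z" "cs b" a D l "[]"] nb by simp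
  show ?case using runs_Cons[OF st Cons.IH[OF nb(2)]] by simp
qed

lemma printer_chain:
  "k \<le> p \<Longrightarrow> runs (printer p) D k (cf 16 l [] []) (cf (16 + k) (l @ replicate k B0) [] [])"
proof (induction k)
  case 0
  then show ?case by (simp add: runs_refl)
next
  case (Suc k)
  have "step (printer p) D (cf (16 + k) (l @ replicate k B0) [] [])
      (cf (16 + Suc k) (l @ replicate (Suc k) B0) [] [])"
    using printer_right[of p "16 + k" "[]" "16 + Suc k" B0 D "l @ replicate k B0" "[]"] Suc.prems
    by (simp add: replicate_append_same)
  then show ?case
    using runs_trans[OF Suc.IH runs_step] Suc.prems by simp
qed

lemma printer_rewind:
  "Bk \<notin> set v \<Longrightarrow> x \<noteq> Bk \<Longrightarrow>
   runs (printer p) D (length v + 2) (cf 3 (l @ Bk # v) (x # r) []) (cf 4 (l @ [Bk]) (v @ x # r) [])"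
proof (induction v arbitrary: x r rule: rev_induct)
  case Nil
  have 1: "step (printer p) D (cf 3 (l @ [Bk]) (x # r) []) (cf 3 l (Bk # x # r) [])"
    using printer_left[of p 3 "x # r" 3 x D l Bk "[]"] Nil by simp
  have 2: "step (printer p) D (cf 3 l (Bk # x # r) []) (cf 4 (l @ [Bk]) (x # r) [])"
    using printer_right[of p 3 "Bk # x # r" 4 Bk D l "[]"] by simp
  show ?case using runs_Cons[OF 1 runs_step[OF 2]] by (simp add: numeral_2_eq_2)
next
  case (snoc y v)
  have nb: "y \<noteq> Bk" "Bk \<notin> set v" using snoc.prems by auto
  have st: "step (printer p) D (cf 3 (l @ Bk # v @ [y]) (x # r) []) (cf 3 (l @ Bk # v) (y # x # r) [])"
    using printer_left[of p 3 "x # r" 3 x D "l @ Bk # v" y "[]"] nb snoc.prems(2) by simp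
  show ?case using runs_Cons[OF st snoc.IH[OF nb(2,1)]] by simp
qed

lemma printer_seek:
  assumes s: "s = (if b then 9 else 8)"
  shows "Bk \<notin> set v \<Longrightarrow> x \<noteq> Bk \<Longrightarrow> runs (printer p) D (length v + 2)
    (cf s (l @ Bk # v) (x # r) []) (cf 10 (l @ bs [b]) (v @ x # r) [])"
proof (induction v arbitrary: x r rule: rev_induct)
  case Nil
  have 1: "step (printer p) D (cf s (l @ [Bk]) (x # r) []) (cf s l (Bk # x # r) [])"
    using printer_left[of p s "x # r" s x D l Bk "[]"] Nil s by simp
  have 2: "step (printer p) D (cf s l (Bk # x # r) []) (cf 10 (l @ bs [b]) (x # r) [])"
    using printer_right[of p s "Bk # x # r" 10 "if b then B1 else B0" D l "[]"] s by simp
  show ?case using runs_Cons[OF 1 runs_step[OF 2]] by (simp add: numeral_2_eq_2)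
next
  case (snoc y v)
  have nb: "y \<noteq> Bk" "Bk \<notin> set v" using snoc.prems by auto
  have st: "step (printer p) D (cf s (l @ Bk # v @ [y]) (x # r) []) (cf s (l @ Bk # v) (y # x # r) [])"
    using printer_left[of p s "x # r" s x D "l @ Bk # v" y "[]"] nb snoc.prems(2) s by simp
  show ?case using runs_Cons[OF st snoc.IH[OF nb(2,1)]] by simp
qed

text \<open>The carried kind bit \<open>c\<close> is dropped in favour of a zero, which increments
  the unary position; state 13 then writes the new kind bit.\<close>

lemma printer_shift:
  "Bk \<notin> set v \<Longrightarrow> c \<noteq> Bk \<Longrightarrow>
   runs (printer p) D (length v + 2) (cf (10 + cs a) l (v @ [c]) []) (cf 13 (l @ a # v @ [B0]) [] [])"
proof (induction v arbitrary: a l)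
  case Nil
  have 1: "step (printer p) D (cf (10 + cs a) l [c] []) (cf (10 + cs c) (l @ [a]) [] [])"
    using printer_right[of p "10 + cs a" "[c]" "10 + cs c" a D l "[]"] Nil by simp
  have 2: "step (printer p) D (cf (10 + cs c) (l @ [a]) [] []) (cf 13 (l @ [a, B0]) [] [])"
    using printer_right[of p "10 + cs c" "[]" 13 B0 D "l @ [a]" "[]"] by simp
  show ?case using runs_Cons[OF 1 runs_step[OF 2]] by (simp add: numeral_2_eq_2)
next
  case (Cons b v)
  have nb: "b \<noteq> Bk" "Bk \<notin> set v" using Cons.prems by auto
  have st: "step (printer p) D (cf (10 + cs a) l (b # v @ [c]) []) (cf (10 + cs b) (l @ [a]) (v @ [c]) [])"
    using printer_right[of p "10 + cs a" "b # v @ [c]" "10 + cs b" a D l "[]"] nb by simp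
  show ?case using runs_Cons[OF st Cons.IH[OF nb(2) Cons.prems(2)]] by simp
qed

lemma printer_copy:
  "Bk \<notin> set v \<Longrightarrow> runs (printer p) D (length v) (cf 4 l v q) (cf 4 (l @ v) [] (q @ v))"
proof (induction v arbitrary: l q)
  case Nil
  then show ?case by (simp add: runs_refl)
next
  case (Cons a v)
  have nb: "a \<noteq> Bk" "Bk \<notin> set v" using Cons.prems by auto
  have st: "step (printer p) D (cf 4 l (a # v) q) (cf 4 (l @ [a]) v (q @ [a]))"
    using nb by (subst step_cf) (simp_all add: cf_def)
  show ?case using runs_Cons[OF st Cons.IH[OF nb(2)]] by simp
qed

text \<open>The final \<open>True\<close> of a display word is written on the query tape only, while
  the work head steps back onto the kind bit \<open>b\<close>, to be read in state 6 or 7.\<close>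

lemma printer_ask:
  "runs (printer p) D (length w + 3) (cf 4 l (bs (w @ [b])) [])
     (cf (if nat_of_word (w @ [b, True]) \<in> D then 6 else 7) (l @ bs w) (bs [b]) [])"
proof -
  have 1: "runs (printer p) D (length w + 1) (cf 4 l (bs (w @ [b])) [])
      (cf 4 (l @ bs (w @ [b])) [] (bs (w @ [b])))"
    using printer_copy[of "bs (w @ [b])" p D l "[]"] by simp
  have 2: "step (printer p) D (cf 4 (l @ bs (w @ [b])) [] (bs (w @ [b])))
      (cf 5 (l @ bs w) (bs [b]) (bs (w @ [b, True])))"
    by (subst step_cf) (auto simp: cf_def tp_snoc_Bk[of "l @ bs w @ [_]", simplified])
  have 3: "step (printer p) D (cf 5 (l @ bs w) (bs [b]) (bs (w @ [b, True])))
     (cf (if nat_of_word (w @ [b, True]) \<in> D then 6 else 7) (l @ bs w) (bs [b]) [])"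
    using step_query[of "printer p" D "l @ bs w" "bs [b]" "w @ [b, True]"] by (simp del: bs_simps)
  show ?thesis
    using runs_trans[OF 1 runs_Cons[OF 2 runs_step[OF 3]]] by (simp add: numeral_3_eq_3)
qed

lemma printer_start:
  "runs (printer p) D (2 * length z + 2 * p + 10) (init (printer p) (nat_of_word z))
     (cf 4 [Bk] (bs (marked (marked z p) 0 @ [False])) [])"
proof -
  let ?l = "Bk # bs z @ B1 # replicate p B0"
  have 1: "runs (printer p) D (Suc (length z)) (cf 0 [] (bs z) []) (cf 15 (Bk # bs z) [] [])"
    using printer_init[of "bs z" p D Bk "[]"] by simp
  have 2: "step (printer p) D (cf 15 (Bk # bs z) [] []) (cf 16 (Bk # bs z @ [B1]) [] [])"
    using printer_right[of p 15 "[]" 16 B1 D "Bk # bs z" "[]"] by simp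
  have 3: "runs (printer p) D p (cf 16 (Bk # bs z @ [B1]) [] []) (cf (16 + p) ?l [] [])"
    using printer_chain[of p p D "Bk # bs z @ [B1]"] by simp
  have 4: "step (printer p) D (cf (16 + p) ?l [] []) (cf (17 + p) (?l @ [B1]) [] [])"
    using printer_right[of p "16 + p" "[]" "17 + p" B1 D ?l "[]"] by simp
  have 5: "step (printer p) D (cf (17 + p) (?l @ [B1]) [] []) (cf 3 ?l [B1, B0] [])"
    using printer_left[of p "17 + p" "[]" 3 B0 D ?l B1 "[]"] by simp
  have 6: "runs (printer p) D (length z + p + 3) (cf 3 ?l [B1, B0] [])
      (cf 4 [Bk] (bs (marked (marked z p) 0 @ [False])) [])"
    using printer_rewind[of "bs z @ B1 # replicate p B0" B1 p D "[]" "[B0]"]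
    by (simp add: marked_def numeral_3_eq_3)
  show ?thesis
    using runs_mono[OF runs_trans[OF 1 runs_Cons[OF 2 runs_trans[OF 3 runs_Cons[OF 4 runs_Cons[OF 5 6]]]]]]
    by (simp add: init_cf)
qed

text \<open>The first query confirms that the position exists, and the kind bit is turned into 1.
  The second one yields the output bit, which replaces the blank; shifting \<open>w\<close> restores
  a blank and appends the zero for the next position.\<close>

lemma printer_round:
  assumes more: "nat_of_word (w @ [False, True]) \<in> D" and w: "w \<noteq> []"
    and b: "b \<longleftrightarrow> nat_of_word (w @ [True, True]) \<in> D"
  shows "runs (printer p) D (7 * length w + 20) (cf 4 (bs y @ [Bk]) (bs (w @ [False])) [])
     (cf 4 (bs (y @ [b]) @ [Bk]) (bs ((w @ [False]) @ [False])) [])"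
proof -
  obtain w' c where w': "w = w' @ [c]" using w by (metis rev_exhaust)
  define x where "x = (if c then B1 else B0)"
  have x: "bs w = bs w' @ [x]" "x \<noteq> Bk" by (auto simp: w' x_def)
  define l where "l = bs y @ Bk # bs w'"
  have lx: "l @ [x] = (bs y @ [Bk]) @ bs w" by (simp add: l_def x)
  define s t where "s = (if b then 9 else 8 :: nat)" and "t = (if b then 6 else 7 :: nat)"
  have 1: "runs (printer p) D (length w + 3) (cf 4 (bs y @ [Bk]) (bs (w @ [False])) [])
      (cf 6 (l @ [x]) [B0] [])"
    using printer_ask[of p D w "bs y @ [Bk]" False] more unfolding lx by simp
  have 2: "step (printer p) D (cf 6 (l @ [x]) [B0] []) (cf 3 l [x, B1] [])"
    using printer_left[of p 6 "[B0]" 3 B1 D l x "[]"] by simp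
  have 3: "runs (printer p) D (length w + 1) (cf 3 l [x, B1] [])
      (cf 4 (bs y @ [Bk]) (bs (w @ [True])) [])"
    using printer_rewind[of "bs w'" x p D "bs y" "[B1]"] x by (simp add: w' l_def)
  have 4: "runs (printer p) D (length w + 3) (cf 4 (bs y @ [Bk]) (bs (w @ [True])) [])
      (cf t (l @ [x]) [B1] [])"
    using printer_ask[of p D w "bs y @ [Bk]" True] b unfolding lx t_def by simp
  have 5: "step (printer p) D (cf t (l @ [x]) [B1] []) (cf s l [x, B1] [])"
    using printer_left[of p t "[B1]" s B1 D l x "[]"] by (simp add: s_def t_def)
  have 6: "runs (printer p) D (length w + 1) (cf s l [x, B1] [])
      (cf 10 (bs (y @ [b])) (bs w @ [B1]) [])"
    using printer_seek[OF s_def, of "bs w'" x p D "bs y" "[B1]"] x by (simp add: w' l_def)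
  have 7: "runs (printer p) D (length w + 2) (cf 10 (bs (y @ [b])) (bs w @ [B1]) [])
      (cf 13 ((bs (y @ [b]) @ Bk # bs w) @ [B0]) [] [])"
    using printer_shift[of "bs w" B1 p D Bk "bs (y @ [b])"] by simp
  have 8: "step (printer p) D (cf 13 ((bs (y @ [b]) @ Bk # bs w) @ [B0]) [] [])
      (cf 3 (bs (y @ [b]) @ Bk # bs w) [B0, B0] [])"
    using printer_left[of p 13 "[]" 3 B0 D "bs (y @ [b]) @ Bk # bs w" B0 "[]"]
    by simp
  have 9: "runs (printer p) D (length w + 2) (cf 3 (bs (y @ [b]) @ Bk # bs w) [B0, B0] [])
      (cf 4 (bs (y @ [b]) @ [Bk]) (bs ((w @ [False]) @ [False])) [])"
    using printer_rewind[of "bs w" B0 p D "bs (y @ [b])" "[B0]"] by simp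
  show ?thesis
    by (rule runs_mono[OF runs_trans[OF 1 runs_Cons[OF 2 runs_trans[OF 3 runs_trans[OF 4
        runs_Cons[OF 5 runs_trans[OF 6 runs_trans[OF 7 runs_Cons[OF 8 9]]]]]]]]]) simp
qed

lemma printer_rounds:
  assumes D: "\<And>j b. nat_of_word (marked (marked z p) j @ [b, True]) \<in> D \<longleftrightarrow> j < length y \<and> (b \<longrightarrow> y ! j)"
    and j: "j \<le> length y"
  shows "runs (printer p) D (j * (7 * (length z + p + length y + 2) + 20))
     (cf 4 [Bk] (bs (marked (marked z p) 0 @ [False])) [])
     (cf 4 (bs (take j y) @ [Bk]) (bs (marked (marked z p) j @ [False])) [])"
  using j
proof (induction j)
  case 0
  then show ?case by (simp add: runs_refl)
next
  case (Suc j)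
  let ?w = "marked (marked z p) j"
  have "runs (printer p) D (7 * length ?w + 20) (cf 4 (bs (take j y) @ [Bk]) (bs (?w @ [False])) [])
     (cf 4 (bs (take j y @ [y ! j]) @ [Bk]) (bs ((?w @ [False]) @ [False])) [])"
    by (rule printer_round) (use Suc.prems D in \<open>auto simp: marked_def\<close>)
  moreover have "?w @ [False] = marked (marked z p) (Suc j)"
    by (simp add: marked_def replicate_append_same)
  moreover have "take j y @ [y ! j] = take (Suc j) y"
    using Suc.prems by (simp add: take_Suc_conv_app_nth)
  ultimately have "runs (printer p) D (7 * length ?w + 20) (cf 4 (bs (take j y) @ [Bk]) (bs (?w @ [False])) [])
     (cf 4 (bs (take (Suc j) y) @ [Bk]) (bs (marked (marked z p) (Suc j) @ [False])) [])"
    by simp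
  then have "runs (printer p) D (7 * (length z + p + length y + 2) + 20)
     (cf 4 (bs (take j y) @ [Bk]) (bs (?w @ [False])) [])
     (cf 4 (bs (take (Suc j) y) @ [Bk]) (bs (marked (marked z p) (Suc j) @ [False])) [])"
    by (rule runs_mono) (use Suc.prems in simp)
  then show ?case
    using runs_trans[OF Suc.IH] Suc.prems by (simp add: add.commute)
qed

lemma printer_result:
  assumes D: "\<And>j b. nat_of_word (marked (marked z p) j @ [b, True]) \<in> D \<longleftrightarrow> j < length y \<and> (b \<longrightarrow> y ! j)"
  obtains n c where "n \<le> (length y + 2) * (7 * (length z + p + length y + 2) + 20)"
    "reach (printer p) D n (nat_of_word z) c" "halted (printer p) D c" "tape_word (wt c) = y"
proof -
  let ?w = "marked (marked z p) (length y)"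
  \<comment> \<open>Behind the last bit the first query is answered negatively. State 7 has no
    transition on kind bit 0, and the blank delimits the output \<open>y\<close>.\<close>
  let ?c = "cf 7 ((bs y @ [Bk]) @ bs ?w) (bs [False]) []"
  have 2: "runs (printer p) D (length ?w + 3) (cf 4 (bs y @ [Bk]) (bs (?w @ [False])) []) ?c"
    using printer_ask[of p D ?w "bs y @ [Bk]" False] D by (simp del: bs_simps)
  have 1: "runs (printer p) D (length y * (7 * (length z + p + length y + 2) + 20))
     (cf 4 [Bk] (bs (marked (marked z p) 0 @ [False])) []) (cf 4 (bs y @ [Bk]) (bs (?w @ [False])) [])"
    using printer_rounds[OF D order_refl] by (simp only: take_all order_refl)
  have "runs (printer p) D ((length y + 2) * (7 * (length z + p + length y + 2) + 20))
      (init (printer p) (nat_of_word z)) ?c"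
    by (rule runs_mono[OF runs_trans[OF printer_start runs_trans[OF 1 2]]]) simp
  then obtain n where n: "n \<le> (length y + 2) * (7 * (length z + p + length y + 2) + 20)"
    "reach (printer p) D n (nat_of_word z) ?c"
    unfolding runs_def reach_def by blast
  have "\<not> step (printer p) D ?c c'" for c' by (subst step_cf) auto
  then have "halted (printer p) D ?c" unfolding halted_def by blast
  moreover have "tape_word (wt ?c) = y"
    using tape_word_tp[of y "bs ?w @ bs [False]"] by (simp add: cf_def)
  ultimately show ?thesis using that n by blast
qed

text \<open>The values are stored in the oracle, so each output bit costs one round of linear time,
  and a polynomial bound on the output length suffices.\<close>

lemma FP_printer:
  assumes D: "\<And>z j b. nat_of_word (marked (marked z p) j @ [b, True]) \<in> D \<longleftrightarrow>
      j < length (\<phi> z) \<and> (b \<longrightarrow> \<phi> z ! j)"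
    and g: "polyb g" "\<And>z. length (\<phi> z) \<le> g (length z)"
  shows "(\<lambda>x. nat_of_word (\<phi> (word_of_nat x))) \<in> FP D"
proof -
  define h where "h = (\<lambda>m. (g m + 2) * (7 * (m + p + g m + 2) + 20))"
  have "polyb h" unfolding h_def by (intro polyb_add polyb_mult polyb_const polyb_id g(1))
  then obtain k where k: "\<And>m. h m \<le> m ^ k + k" using polyb_time by blast
  have result: "\<exists>n c. n \<le> len x ^ k + k \<and> reach (printer p) D n x c \<and> halted (printer p) D c \<and>
      tape_word (wt c) = \<phi> (word_of_nat x)" for x
  proof -
    let ?z = "word_of_nat x"
    obtain n c where n: "n \<le> (length (\<phi> ?z) + 2) * (7 * (length ?z + p + length (\<phi> ?z) + 2) + 20)"
      "reach (printer p) D n (nat_of_word ?z) c" "halted (printer p) D c" "tape_word (wt c) = \<phi> ?z"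
      by (rule printer_result[of ?z p D "\<phi> ?z"]) (auto simp: D)
    have "(length (\<phi> ?z) + 2) * (7 * (length ?z + p + length (\<phi> ?z) + 2) + 20) \<le> h (len x)"
      unfolding h_def using g(2)[of ?z] by (intro mult_le_mono) auto
    then show ?thesis using n k[of "len x"] by (metis nat_of_word_of_nat order_trans)
  qed
  have "time_bound (printer p) D k"
    unfolding time_bound_def
    using result deterministic_time[OF deterministic_printer] by (meson order_trans)
  then show ?thesis
    unfolding FP_def poly_time_def using finite_printer deterministic_printer result by fastforce
qed

section \<open>A machine guessing a witness\<close>

definition gtrans :: "bool \<Rightarrow> nat \<Rightarrow> ((nat \<times> sym \<times> sym) \<times> (nat \<times> sym \<times> sym \<times> move \<times> move)) set" where
  "gtrans t c = {((q, a, b), (q', a', b', m, m')). a' = a \<and> m' = MoveR \<and>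
    (q = 0 \<and> q' = 1 \<and> b' = (if t then B1 else B0) \<and> m = MoveS \<or>
     q = 1 \<and> a \<noteq> Bk \<and> q' = 1 \<and> b' \<noteq> Bk \<and> m = MoveR \<or>
     q = 1 \<and> a = Bk \<and> q' = 2 \<and> b' = B1 \<and> m = MoveS \<or>
     2 \<le> q \<and> q \<le> 2 + c \<and> q' = Suc q \<and> b' = B0 \<and> m = MoveS)}"

text \<open>The machine writes \<open>t\<close>, one guessed bit per input symbol, a 1 and
  \<open>Suc c\<close> zeros, which spells \<open>gword t y c\<close>. The state for a positive
  answer is the accepting one.\<close>

definition guesser :: "bool \<Rightarrow> nat \<Rightarrow> otm" where
  "guesser t c = \<lparr>delta = gtrans t c, q_start = 0, q_acc = 4 + c, q_query = 3 + c,
     q_yes = 4 + c, q_no = 5 + c\<rparr>"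

lemma guesser_simps [simp]:
  "q_start (guesser t c) = 0" "q_acc (guesser t c) = 4 + c" "q_query (guesser t c) = 3 + c"
  "q_yes (guesser t c) = 4 + c" "q_no (guesser t c) = 5 + c" "delta (guesser t c) = gtrans t c"
  by (auto simp: guesser_def)

lemma finite_guesser: "finite (delta (guesser t c))"
  by (rule finite_delta[of _ "c + 5"]) (auto simp: gtrans_def)

text \<open>The configuration after \<open>n\<close> steps if the guess will be \<open>y\<close>.
  The first step writes \<open>t\<close>, so \<open>n - 1\<close> bits of \<open>y\<close> are
  written while the input is being read.\<close>

definition guess_conf :: "bool \<Rightarrow> nat \<Rightarrow> nat set \<Rightarrow> bool list \<Rightarrow> bool list \<Rightarrow> nat \<Rightarrow> config" where
  "guess_conf t c D x y n =
    (if n = 0 then cf 0 [] (bs x) []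
     else if n \<le> Suc (length x) then
       cf 1 (bs (take (n - 1) x)) (bs (drop (n - 1) x)) (bs (t # take (n - 1) y))
     else if n \<le> length x + c + 3 then
       cf (n - length x) (bs x) [] (bs (t # y @ True # replicate (n - length x - 2) False))
     else cf (if nat_of_word (gword t y c) \<in> D then 4 + c else 5 + c) (bs x) [] [])"

lemma cf_stay:
  "Config s (tp (l @ rd r # tl r)) (mv MoveS (length l)) (tp (q @ [b])) (mv MoveR (length q)) =
   cf s l r (q @ [b])"
  by (cases r) (simp_all add: cf_def tp_snoc_Bk)

lemma cf_advance:
  "Config s (tp (l @ a # tl r)) (mv MoveR (length l)) (tp (q @ [b])) (mv MoveR (length q)) =
   cf s (l @ [a]) (tl r) (q @ [b])"
  by (simp add: cf_def)

lemma neq_Bk_iff: "a \<noteq> Bk \<longleftrightarrow> (\<exists>b. [a] = bs [b])"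
  by (cases a) (auto simp: bs_def intro: exI[of _ True] exI[of _ False])

lemma guesser_step:
  assumes "s \<noteq> 3 + c" "s \<noteq> 4 + c"
  shows "step (guesser t c) D (cf s l r q) c' \<longleftrightarrow>
    s = 0 \<and> c' = cf 1 l r (q @ bs [t]) \<or>
    s = 1 \<and> rd r \<noteq> Bk \<and> (\<exists>b. c' = cf 1 (l @ [rd r]) (tl r) (q @ bs [b])) \<or>
    s = 1 \<and> rd r = Bk \<and> c' = cf 2 l r (q @ bs [True]) \<or>
    2 \<le> s \<and> s \<le> 2 + c \<and> c' = cf (Suc s) l r (q @ bs [False])"
proof -
  have "step (guesser t c) D (cf s l r q) c' \<longleftrightarrow>
      (\<exists>s' a b m1 m2. ((s, rd r, Bk), (s', a, b, m1, m2)) \<in> gtrans t c \<and>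
        c' = Config s' (tp (l @ a # tl r)) (mv m1 (length l)) (tp (q @ [b])) (mv m2 (length q)))"
    using assms by (subst step_cf) auto
  also have "\<dots> \<longleftrightarrow> s = 0 \<and> c' = cf 1 l r (q @ [if t then B1 else B0]) \<or>
    s = 1 \<and> rd r \<noteq> Bk \<and> (\<exists>b. b \<noteq> Bk \<and> c' = cf 1 (l @ [rd r]) (tl r) (q @ [b])) \<or>
    s = 1 \<and> rd r = Bk \<and> c' = cf 2 l r (q @ [B1]) \<or>
    2 \<le> s \<and> s \<le> 2 + c \<and> c' = cf (Suc s) l r (q @ [B0])"
    by (simp add: gtrans_def ex_disj_distrib conj_disj_distribL conj_disj_distribR
        cf_stay cf_advance del: mv.simps)
  also have "(\<exists>b. b \<noteq> Bk \<and> c' = cf 1 (l @ [rd r]) (tl r) (q @ [b])) \<longleftrightarrow>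
    (\<exists>b. c' = cf 1 (l @ [rd r]) (tl r) (q @ bs [b]))"
    unfolding neq_Bk_iff by (metis bs_simps(1,2))
  finally show ?thesis by simp
qed

text \<open>A step guesses at most one more bit, expressed by exchanging \<open>y\<close> for any
  \<open>y'\<close> with the same bits guessed so far.\<close>

lemma guess_conf_step:
  assumes y: "length y = length x" and n: "n \<le> length x + c + 4"
  shows "step (guesser t c) D (guess_conf t c D x y n) c' \<longleftrightarrow> n < length x + c + 4 \<and>
    (\<exists>y'. length y' = length x \<and> take (n - 1) y' = take (n - 1) y \<and> c' = guess_conf t c D x y' (Suc n))"
proof -
  \<comment> \<open>Once the input is read, all of \<open>y\<close> has been guessed and
    \<open>y' = y\<close> is forced.\<close>
  have all: "(\<exists>y'. length y' = length x \<and> take (n - 1) y' = take (n - 1) y \<and> c' = guess_conf t c D x y' (Suc n)) \<longleftrightarrow>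
      c' = guess_conf t c D x y (Suc n)" if "length x < n"
    using that y by (metis Suc_pred' less_Suc_eq_le less_imp_diff_less not_less_zero order.strict_trans2
      take_all zero_less_iff_neq_zero)
  consider "n = 0" | "1 \<le> n" "n \<le> length x" | "n = length x + 1"
    | "length x + 2 \<le> n" "n \<le> length x + c + 2" | "n = length x + c + 3" | "n = length x + c + 4"
    using n by linarith
  then show ?thesis
  proof cases
    case 1
    then show ?thesis
      using y by (auto simp: guess_conf_def guesser_step)
  next
    case 2
    define i where "i = n - 1"
    have i: "i < length x" "n = Suc i" using 2 by (auto simp: i_def)
    have r: "bs (drop i x) = bs [x ! i] @ bs (drop (Suc i) x)"
      using i(1) by (metis Cons_nth_drop_Suc append_Cons append_Nil bs_simps(3))
    have l: "bs (take (Suc i) x) = bs (take i x) @ bs [x ! i]"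
      using i(1) by (simp add: take_Suc_conv_app_nth del: bs_simps(2))
    have conf: "guess_conf t c D x y n = cf 1 (bs (take i x)) (bs (drop i x)) (bs (t # take i y))"
      using i by (simp add: guess_conf_def)
    have "step (guesser t c) D (guess_conf t c D x y n) c' \<longleftrightarrow>
      (\<exists>b. c' = cf 1 (bs (take (Suc i) x)) (bs (drop (Suc i) x)) (bs (t # take i y) @ bs [b]))"
      unfolding conf by (subst guesser_step) (auto simp: r l)
    also have "\<dots> \<longleftrightarrow> (\<exists>b. c' = cf 1 (bs (take (Suc i) x)) (bs (drop (Suc i) x)) (bs (t # take i y @ [b])))"
      by simp
    also have "\<dots> \<longleftrightarrow> (\<exists>y'. length y' = length x \<and> take i y' = take i y \<and>
       c' = cf 1 (bs (take (Suc i) x)) (bs (drop (Suc i) x)) (bs (t # take (Suc i) y')))"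
    proof
      assume "\<exists>b. c' = cf 1 (bs (take (Suc i) x)) (bs (drop (Suc i) x)) (bs (t # take i y @ [b]))"
      then obtain b where b: "c' = cf 1 (bs (take (Suc i) x)) (bs (drop (Suc i) x)) (bs (t # take i y @ [b]))"
        by blast
      have "take (Suc i) (y[i := b]) = take i y @ [b]"
        using i(1) y by (simp add: take_Suc_conv_app_nth)
      then show "\<exists>y'. length y' = length x \<and> take i y' = take i y \<and>
         c' = cf 1 (bs (take (Suc i) x)) (bs (drop (Suc i) x)) (bs (t # take (Suc i) y'))"
        using y b by (intro exI[of _ "y[i := b]"]) simp
    next
      assume "\<exists>y'. length y' = length x \<and> take i y' = take i y \<and>
         c' = cf 1 (bs (take (Suc i) x)) (bs (drop (Suc i) x)) (bs (t # take (Suc i) y'))"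
      then obtain y' where y': "length y' = length x" "take i y' = take i y"
         "c' = cf 1 (bs (take (Suc i) x)) (bs (drop (Suc i) x)) (bs (t # take (Suc i) y'))"
        by blast
      then have "take (Suc i) y' = take i y @ [y' ! i]"
        using i(1) by (simp add: take_Suc_conv_app_nth)
      then show "\<exists>b. c' = cf 1 (bs (take (Suc i) x)) (bs (drop (Suc i) x)) (bs (t # take i y @ [b]))"
        using y'(3) by metis
    qed
    finally show ?thesis using i by (simp add: guess_conf_def)
  next
    case 3
    have "guess_conf t c D x y n = cf 1 (bs x) [] (bs (t # y))"
      using 3 y by (simp add: guess_conf_def)
    moreover have "guess_conf t c D x y (Suc n) = cf 2 (bs x) [] (bs (t # y) @ bs [True])"
      using 3 by (simp add: guess_conf_def)
    ultimately show ?thesis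
      using 3 all by (simp add: guesser_step del: bs_simps)
  next
    case 4
    then obtain j where j: "n = length x + 2 + j" "j \<le> c" by (metis add_le_cancel_left le_Suc_ex
      add.assoc add.commute)
    have "guess_conf t c D x y n = cf (2 + j) (bs x) [] (bs (t # y @ True # replicate j False))"
      using j by (simp add: guess_conf_def)
    moreover have "guess_conf t c D x y (Suc n) =
        cf (Suc (2 + j)) (bs x) [] (bs (t # y @ True # replicate j False) @ bs [False])"
      using j by (simp add: guess_conf_def replicate_append_same[symmetric] numeral_3_eq_3)
    ultimately show ?thesis
      using j all by (simp add: guesser_step del: bs_simps)
  next
    case 5
    have "guess_conf t c D x y n = cf (q_query (guesser t c)) (bs x) [] (bs (gword t y c))"
      using 5 by (simp add: guess_conf_def gword_def marked_def add.commute)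
    moreover have "guess_conf t c D x y (Suc n) =
        cf (if nat_of_word (gword t y c) \<in> D then 4 + c else 5 + c) (bs x) [] []"
      using 5 by (simp add: guess_conf_def)
    moreover have "q_query (guesser t c) \<noteq> q_acc (guesser t c)" by simp
    ultimately show ?thesis
      using 5 all step_query[of "guesser t c"] by simp
  next
    case 6
    have conf: "guess_conf t c D x y n =
        cf (if nat_of_word (gword t y c) \<in> D then 4 + c else 5 + c) (bs x) [] []"
      using 6 by (simp add: guess_conf_def)
    have "\<not> step (guesser t c) D (cf (4 + c) (bs x) [] []) c'"
      by (simp add: step_def cf_def)
    moreover have "\<not> step (guesser t c) D (cf (5 + c) (bs x) [] []) c'"
      by (subst guesser_step) auto
    ultimately show ?thesis using 6 conf by simp
  qed
qed

text \<open>An exact description of all runs, giving the time bound as well as both directions of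
  the acceptance criterion.\<close>

lemma guesser_reach:
  "reach (guesser t c) D n (nat_of_word x) c' \<longleftrightarrow>
   n \<le> length x + c + 4 \<and> (\<exists>y. length y = length x \<and> c' = guess_conf t c D x y n)"
proof (induction n arbitrary: c')
  case 0
  have "\<exists>y :: bool list. length y = length x" by blast
  then show ?case by (auto simp: reach_def guess_conf_def init_cf)
next
  case (Suc n)
  have "reach (guesser t c) D (Suc n) (nat_of_word x) c' \<longleftrightarrow>
    (\<exists>b. reach (guesser t c) D n (nat_of_word x) b \<and> step (guesser t c) D b c')"
    by (auto simp: reach_def)
  also have "\<dots> \<longleftrightarrow> Suc n \<le> length x + c + 4 \<and> (\<exists>y. length y = length x \<and> c' = guess_conf t c D x y (Suc n))"
    unfolding Suc.IH using guess_conf_step[of _ x n c t D c'] by (metis Suc_leD Suc_le_eq)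
  finally show ?case .
qed

lemma guesser_accepts:
  "accepts (guesser t c) D (nat_of_word x) \<longleftrightarrow>
     (\<exists>y. length y = length x \<and> nat_of_word (gword t y c) \<in> D)"
proof
  assume "accepts (guesser t c) D (nat_of_word x)"
  then obtain n c' where n: "reach (guesser t c) D n (nat_of_word x) c'" "st c' = 4 + c"
    by (auto simp: accepts_def accepts_within_def)
  then obtain y where y: "length y = length x" "c' = guess_conf t c D x y n" "n \<le> length x + c + 4"
    unfolding guesser_reach by blast
  then have "nat_of_word (gword t y c) \<in> D"
    using n(2) by (auto simp: guess_conf_def cf_def split: if_splits)
  then show "\<exists>y. length y = length x \<and> nat_of_word (gword t y c) \<in> D" using y(1) by blast
next
  assume "\<exists>y. length y = length x \<and> nat_of_word (gword t y c) \<in> D"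
  then obtain y where y: "length y = length x" "nat_of_word (gword t y c) \<in> D" by blast
  let ?n = "length x + c + 4"
  have "reach (guesser t c) D ?n (nat_of_word x) (guess_conf t c D x y ?n)"
    unfolding guesser_reach using y(1) by blast
  moreover have "st (guess_conf t c D x y ?n) = 4 + c"
    using y(2) by (simp add: guess_conf_def cf_def)
  ultimately show "accepts (guesser t c) D (nat_of_word x)"
    by (auto simp: accepts_def accepts_within_def)
qed

lemma NP_guesser:
  "{x. \<exists>y. length y = len x \<and> nat_of_word (gword t y c) \<in> D} \<in> NP D"
proof -
  have "n \<le> len x ^ (c + 4) + (c + 4)" if "reach (guesser t c) D n x c'" for n x c'
  proof -
    have "n \<le> len x + c + 4"
      using that guesser_reach[of t c D n "word_of_nat x" c'] by simp
    moreover have "len x \<le> len x ^ (c + 4)"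
      by (cases "len x = 0") (simp_all add: self_le_power)
    ultimately show ?thesis by linarith
  qed
  then have "poly_time (guesser t c) D" unfolding poly_time_def time_bound_def by blast
  moreover have "accepts (guesser t c) D x \<longleftrightarrow> (\<exists>y. length y = len x \<and> nat_of_word (gword t y c) \<in> D)" for x
    using guesser_accepts[of t c D "word_of_nat x"] by simp
  ultimately show ?thesis
    unfolding NP_def using finite_guesser by blast
qed

text \<open>Halted configurations idle, so every larger clock gives the same value; hence the clock
  can be a tag that is chosen later.\<close>

lemma FP_clocked:
  assumes "f \<in> FP D"
  obtains M k where "finite (delta M)" "\<And>s x. k < s \<Longrightarrow> clocked M s D x = f x"
proof -
  obtain M k where M: "finite (delta M)" "deterministic M" "time_bound M D k"
    "\<And>x. \<exists>n c. reach M D n x c \<and> halted M D c \<and> nat_of_word (tape_word (wt c)) = f x"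
    using assms unfolding FP_def poly_time_def by blast
  have "clocked M s D x = f x" if "k < s" for s x
  proof -
    obtain n c where c: "reach M D n x c" "halted M D c" "nat_of_word (tape_word (wt c)) = f x"
      using M(4) by blast
    have "n \<le> len x ^ s + s"
      using time_bound_mono[OF M(3), of s] that c(1) by (auto simp: time_bound_def)
    then show ?thesis using clocked_eq[OF M(2) c(1,2)] c(3) by simp
  qed
  then show ?thesis using that M(1) by blast
qed

text \<open>Every larger exponent works too, so a language and its complement can share one.\<close>

lemma NP_acc:
  assumes "L \<in> NP D"
  obtains M k where "finite (delta M)" "\<And>s x. k < s \<Longrightarrow> acc M s D x \<longleftrightarrow> x \<in> L"
proof -
  obtain M k where M: "finite (delta M)" "time_bound M D k" "L = {x. accepts M D x}"
    using assms unfolding NP_def poly_time_def by blast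
  have "acc M s D x \<longleftrightarrow> x \<in> L" if "k < s" for s x
  proof -
    have "n \<le> len x ^ s + s" if "reach M D n x c" for n c
      using time_bound_mono[OF M(2), of s] that \<open>k < s\<close> by (auto simp: time_bound_def)
    then show ?thesis
      unfolding M(3) acc_def accepts_def accepts_within_def by blast
  qed
  then show ?thesis using that M(1) by blast
qed

theorem theorem3p2:
  fixes Ms :: "nat \<Rightarrow> otm"
  assumes "standard_enum Ms"
  shows "\<exists>Orc :: nat set.
           \<not> (\<exists>C \<in> NP Orc \<inter> coNP Orc. \<forall>A \<in> NP Orc \<inter> coNP Orc. many_one Orc A C) \<and>
           (\<exists>g. optimal_ps Orc (- K Ms Orc) g)"
proof (rule generic_exists[of Ms])
  fix B \<Gamma>
  assume len: "\<And>z. length (\<Gamma> z) \<le> length z"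
    and range: "range (\<lambda>z. nat_of_word (\<Gamma> z)) = - K Ms (orc B \<Gamma>)"
    and sim: "\<And>M k. finite (delta M) \<Longrightarrow> \<exists>s>k. (\<forall>x. \<Gamma> (code s x) = eval_word M s (orc B \<Gamma>) x) \<or>
        (\<exists>x. nat_of_word (eval_word M s (orc B \<Gamma>) x) \<in> K Ms (orc B \<Gamma>))"
    and diag: "\<And>Ma Mb k. finite (delta Ma) \<Longrightarrow> finite (delta Mb) \<Longrightarrow>
       (\<forall>q. acc Ma k (orc B \<Gamma>) q \<noteq> acc Mb k (orc B \<Gamma>) q) \<Longrightarrow>
       \<exists>c. exclusive B c \<and> (\<forall>M s. finite (delta M) \<longrightarrow>
         (\<exists>n. has B c False n \<noteq> acc Ma k (orc B \<Gamma>) (clocked M s (orc B \<Gamma>) (zeros n))))"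
  define D where "D = orc B \<Gamma>"
  note range = range[folded D_def] and sim = sim[folded D_def] and diag = diag[folded D_def]
  define g where "g = (\<lambda>x. nat_of_word (\<Gamma> (word_of_nat x)))"
  have "g \<in> FP D"
    unfolding g_def
    by (rule FP_printer[where p = 0 and g = "\<lambda>m. m"]) (auto simp: D_def orc_display Phi_def len)
  moreover have "range g = - K Ms D"
  proof -
    have surj: "range word_of_nat = UNIV" by (rule surjI[of _ nat_of_word]) simp
    have "range g = (\<lambda>z. nat_of_word (\<Gamma> z)) ` range word_of_nat"
      by (simp add: g_def image_image)
    then show ?thesis unfolding surj range .
  qed
  moreover have "p_sim D f g" if f: "proof_system D (- K Ms D) f" for f
  proof -
    obtain M k where M: "finite (delta M)" "\<And>s x. k < s \<Longrightarrow> clocked M s D x = f x"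
      by (rule FP_clocked[of f D]) (use f in \<open>auto simp: proof_system_def\<close>)
    obtain s where s: "k < s" "(\<forall>x. \<Gamma> (code s x) = eval_word M s D x) \<or>
        (\<exists>x. nat_of_word (eval_word M s D x) \<in> K Ms D)"
      using sim[OF M(1)] by blast
    have ev: "nat_of_word (eval_word M s D x) = f (nat_of_word x)" for x
      using M(2)[OF s(1)] by (simp add: eval_word_def)
    \<comment> \<open>A proof system never outputs an element of \<open>K\<close>, which excludes
      the second alternative for \<open>s\<close>.\<close>
    have "f x \<notin> K Ms D" for x using f by (auto simp: proof_system_def)
    then have \<Gamma>: "\<Gamma> (code s x) = eval_word M s D x" for x using s(2) ev by auto
    \<comment> \<open>As \<open>k < s\<close>, the tag \<open>s\<close> is positive, so level
      \<open>s\<close> of \<open>Phi\<close> displays the codes and the printer computes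
      \<pi>.\<close>
    define \<pi> where "\<pi> = (\<lambda>x. nat_of_word (code s (word_of_nat x)))"
    have "\<pi> \<in> FP D"
      unfolding \<pi>_def
    proof (rule FP_printer[where p = s and g = "\<lambda>m. m + s + 2 + (m + m ^ s + s) * (m + m ^ s + s)"])
      show "polyb (\<lambda>m. m + s + 2 + (m + m ^ s + s) * (m + m ^ s + s))"
        by (intro polyb_add polyb_mult polyb_power polyb_const polyb_id)
    qed (use s(1) in \<open>auto simp: D_def orc_display Phi_def length_code bnd_def power2_eq_square\<close>)
    moreover have "g (\<pi> x) = f x" for x
      by (simp add: g_def \<pi>_def \<Gamma> ev)
    ultimately show ?thesis unfolding p_sim_def by blast
  qed
  ultimately have opt: "optimal_ps D (- K Ms D) g"
    by (simp add: optimal_ps_def proof_system_def)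
  have "\<exists>A \<in> NP D \<inter> coNP D. \<not> many_one D A C" if C: "C \<in> NP D \<inter> coNP D" for C
  proof -
    obtain Ma ka where Ma: "finite (delta Ma)" "\<And>s x. ka < s \<Longrightarrow> acc Ma s D x \<longleftrightarrow> x \<in> C"
      by (rule NP_acc[of C D]) (use C in auto)
    obtain Mb kb where Mb: "finite (delta Mb)" "\<And>s x. kb < s \<Longrightarrow> acc Mb s D x \<longleftrightarrow> x \<in> - C"
      by (rule NP_acc[of "- C" D]) (use C in \<open>auto simp: coNP_def\<close>)
    define k where "k = Suc (max ka kb)"
    have k: "acc Ma k D q \<longleftrightarrow> q \<in> C" "acc Mb k D q \<longleftrightarrow> q \<notin> C" for q
      using Ma(2)[of k q] Mb(2)[of k q] by (auto simp: k_def)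
    obtain c where c: "exclusive B c"
      "\<And>M s. finite (delta M) \<Longrightarrow> \<exists>n. has B c False n \<noteq> acc Ma k D (clocked M s D (zeros n))"
      using diag[OF Ma(1) Mb(1), of k] k by auto
    define A where "A = {x. has B c False (len x)}"
    have NP: "{x. has B c t (len x)} \<in> NP D" for t
      using NP_guesser[of t c D] by (simp add: has_def D_def gword_orc)
    \<comment> \<open>By exclusivity the complement is the language of the other kind, to which the
      guessing machine applies as well.\<close>
    have "- A = {x. has B c True (len x)}" using c(1) by (auto simp: A_def exclusive_def)
    then have "A \<in> NP D \<inter> coNP D" using NP by (simp add: coNP_def A_def)
    moreover have "\<not> many_one D A C"
    proof
      assume "many_one D A C"
      then obtain f where f: "f \<in> FP D" "\<And>x. x \<in> A \<longleftrightarrow> f x \<in> C" unfolding many_one_def by blast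
      obtain M l where M: "finite (delta M)" "\<And>s x. l < s \<Longrightarrow> clocked M s D x = f x"
        using FP_clocked[OF f(1)] by blast
      obtain n where n: "has B c False n \<noteq> acc Ma k D (clocked M (Suc l) D (zeros n))"
        using c(2)[OF M(1)] by blast
      then have "zeros n \<in> A \<longleftrightarrow> f (zeros n) \<notin> C"
        using k(1) M(2)[of "Suc l"] by (simp add: A_def)
      then show False using f(2) by blast
    qed
    ultimately show ?thesis by blast
  qed
  then show ?thesis using opt by blast
qed

end
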